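(* The map $$\operatorname{Im}_{H^*}:(\operatorname{Vect}_n(X),\leqq_L)\to(\mathcal{S}ub(H^*(X;\mathbb{Z})),\leqq),\qquad \operatorname{Im}_{H^*}([E]):=\operatorname{Im}\bigl(f_E^*:H^*(G_n(\mathbb{C}^\infty);\mathbb{Z})\to H^*(X;\mathbb{Z})\bigr)=\operatorname{Char}(E)$$ is well-defined and monotone (order-preserving). That is, for complex vector bundles $E,F$ of rank $n$ over $X$, $$[E]\leqq_L[F]\Longrightarrow\operatorname{Char}(E)\subseteq\operatorname{Char}(F),$$ and also $$[E]\sim_L[F]\Longrightarrow\operatorname{Char}(E)=\operatorname{Char}(F).$$
   Context: $\operatorname{Vect}_n(X)$ is the set of isomorphism classes $[E]$ of complex vector bundles of rank $n$ over $X$; $G_n(\mathbb{C}^\infty)$ is the infinite Grassmannian of complex $n$-planes in $\mathbb{C}^\infty$, and $\gamma^n$ is the universal rank $n$ bundle over it. $X$ is a space for which $[f]\mapsto[f^*\gamma^n]$ is a bijection $[X,G_n(\mathbb{C}^\infty)]\cong\operatorname{Vect}_n(X)$ (e.g. $X$ paracompact Hausdorff), where $[X,Y]$ denotes the set of homotopy classes of continuous maps. $f_E:X\to G_n(\mathbb{C}^\infty)$ denotes a classifying map of $E$, i.e. $E\cong f_E^*\gamma^n$. For $[f],[g]\in[X,Y]$, $[f]\leqq_L[g]$ iff there is $[t]\in[Y,Y]$ with $[f]=[t]\circ[g]$. On $\operatorname{Vect}_n(X)$: $[E]\leqq_L[F]$ iff $[f_E]\leqq_L[f_F]$, and $[E]\sim_L[F]$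 iff $[E]\leqq_L[F]$ and $[F]\leqq_L[E]$. $\operatorname{Char}(E)$ is the subring of $H^*(X;\mathbb{Z})$ consisting of all characteristic classes $f_E^*(\alpha)$, $\alpha\in H^*(G_n(\mathbb{C}^\infty);\mathbb{Z})$, of $E$. For a group $G$, $\mathcal{S}ub(G)$ is the set of subgroups of $G$ ordered by inclusion. *)

theory Defs
  imports "HOL-Homology.Homology" "HOL-Algebra.QuotRing"
begin

section \<open>Quotient and colimit topologies\<close>

definition quotient_topology :: "'a topology \<Rightarrow> ('a \<Rightarrow> 'b) \<Rightarrow> 'b topology" where
  "quotient_topology X q =
     topology (\<lambda>U. U \<subseteq> q ` topspace X \<and> openin X {x \<in> topspace X. q x \<in> U})"

lemma openin_quotient_topology:
  "openin (quotient_topology X q) U \<longleftrightarrow>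
     U \<subseteq> q ` topspace X \<and> openin X {x \<in> topspace X. q x \<in> U}"
proof -
  have "istopology (\<lambda>U. U \<subseteq> q ` topspace X \<and> openin X {x \<in> topspace X. q x \<in> U})"
    unfolding istopology_def
  proof (intro conjI allI impI)
    fix S T
    assume "S \<subseteq> q ` topspace X \<and> openin X {x \<in> topspace X. q x \<in> S}"
      and "T \<subseteq> q ` topspace X \<and> openin X {x \<in> topspace X. q x \<in> T}"
    moreover have "{x \<in> topspace X. q x \<in> S \<inter> T} =
        {x \<in> topspace X. q x \<in> S} \<inter> {x \<in> topspace X. q x \<in> T}" by auto
    ultimately show "S \<inter> T \<subseteq> q ` topspace X" and "openin X {x \<in> topspace X. q x \<in> S \<inter> T}"
      by auto
  next
    fix K
    assume K: "\<forall>S\<in>K. S \<subseteq> q ` topspace X \<and> openin X {x \<in> topspace X. q x \<in> S}"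
    have "{x \<in> topspace X. q x \<in> \<Union>K} = (\<Union>S\<in>K. {x \<in> topspace X. q x \<in> S})" by auto
    with K show "\<Union>K \<subseteq> q ` topspace X" and "openin X {x \<in> topspace X. q x \<in> \<Union>K}"
      by auto
  qed
  then show ?thesis
    by (simp add: quotient_topology_def)
qed

lemma topspace_quotient_topology: "topspace (quotient_topology X q) = q ` topspace X"
proof
  show "topspace (quotient_topology X q) \<subseteq> q ` topspace X"
    using openin_quotient_topology openin_topspace by metis
  have "{x \<in> topspace X. q x \<in> q ` topspace X} = topspace X" by auto
  then have "openin (quotient_topology X q) (q ` topspace X)"
    by (simp add: openin_quotient_topology)
  then show "q ` topspace X \<subseteq> topspace (quotient_topology X q)"
    by (rule openin_subset)
qed

lemma quotient_map_quotient_topology: "quotient_map X (quotient_topology X q) q"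
  by (simp add: quotient_map_def topspace_quotient_topology openin_quotient_topology)

definition colimit_topology :: "(nat \<Rightarrow> 'a topology) \<Rightarrow> 'a topology" where
  "colimit_topology T =
     topology (\<lambda>U. U \<subseteq> (\<Union>k. topspace (T k)) \<and> (\<forall>k. openin (T k) (U \<inter> topspace (T k))))"

lemma openin_colimit_topology:
  "openin (colimit_topology T) U \<longleftrightarrow>
     U \<subseteq> (\<Union>k. topspace (T k)) \<and> (\<forall>k. openin (T k) (U \<inter> topspace (T k)))"
proof -
  have "istopology (\<lambda>U. U \<subseteq> (\<Union>k. topspace (T k)) \<and> (\<forall>k. openin (T k) (U \<inter> topspace (T k))))"
    unfolding istopology_def
  proof (intro conjI allI impI)
    fix S S' k
    assume *: "S \<subseteq> (\<Union>k. topspace (T k)) \<and> (\<forall>k. openin (T k) (S \<inter> topspace (T k)))"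
      "S' \<subseteq> (\<Union>k. topspace (T k)) \<and> (\<forall>k. openin (T k) (S' \<inter> topspace (T k)))"
    show "S \<inter> S' \<subseteq> (\<Union>k. topspace (T k))" using * by blast
    have "S \<inter> S' \<inter> topspace (T k) = (S \<inter> topspace (T k)) \<inter> (S' \<inter> topspace (T k))" by blast
    with * show "openin (T k) (S \<inter> S' \<inter> topspace (T k))" by (metis openin_Int)
  next
    fix K k
    assume K: "\<forall>S\<in>K. S \<subseteq> (\<Union>k. topspace (T k)) \<and> (\<forall>k. openin (T k) (S \<inter> topspace (T k)))"
    show "\<Union>K \<subseteq> (\<Union>k. topspace (T k))" using K by blast
    have "\<Union>K \<inter> topspace (T k) = (\<Union>S\<in>K. S \<inter> topspace (T k))" by blast
    then show "openin (T k) (\<Union>K \<inter> topspace (T k))"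
      using K by (metis (no_types, lifting) imageE openin_Union)
  qed
  then show ?thesis
    by (simp add: colimit_topology_def)
qed

lemma topspace_colimit_topology: "topspace (colimit_topology T) = (\<Union>k. topspace (T k))"
proof
  show "topspace (colimit_topology T) \<subseteq> (\<Union>k. topspace (T k))"
    using openin_colimit_topology openin_topspace by metis
  have "(\<Union>k. topspace (T k)) \<inter> topspace (T k) = topspace (T k)" for k by blast
  then have "openin (colimit_topology T) (\<Union>k. topspace (T k))"
    by (simp add: openin_colimit_topology)
  then show "(\<Union>k. topspace (T k)) \<subseteq> topspace (colimit_topology T)"
    by (rule openin_subset)
qed

section \<open>The infinite Grassmannian\<close>

text \<open>A vector is a sequence of complex numbers; \<open>\<complex>\<^sup>k\<close> consists of the sequences
  supported on the indices below \<open>k\<close>, so that \<open>\<complex>\<^sup>0 \<subseteq> \<complex>\<^sup>1 \<subseteq> \<dots> \<subseteq> \<complex>\<^sup>\<infinity>\<close> are literal inclusions.\<close>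

type_synonym cvec = "nat \<Rightarrow> complex"

definition cvec_add :: "cvec \<Rightarrow> cvec \<Rightarrow> cvec" where
  "cvec_add v w = (\<lambda>i. v i + w i)"

definition cvec_scale :: "complex \<Rightarrow> cvec \<Rightarrow> cvec" where
  "cvec_scale c v = (\<lambda>i. c * v i)"

definition cspace :: "nat \<Rightarrow> cvec topology" where
  "cspace k = subtopology euclidean {v. \<forall>i\<ge>k. v i = 0}"

definition cspace_inf :: "cvec topology" where
  "cspace_inf = colimit_topology cspace"

text \<open>The Stiefel space of linearly independent \<open>n\<close>-frames in \<open>\<complex>\<^sup>k\<close>; the frame is
  \<open>v 0, \<dots>, v (n - 1)\<close>, and the junk entries from \<open>n\<close> on are fixed to be \<open>0\<close>.\<close>

definition stiefel :: "nat \<Rightarrow> nat \<Rightarrow> (nat \<Rightarrow> cvec) topology" where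
  "stiefel n k = subtopology euclidean
     {v. (\<forall>j<n. v j \<in> topspace (cspace k)) \<and> (\<forall>j\<ge>n. v j = (\<lambda>i. 0)) \<and>
         (\<forall>c. (\<forall>i. (\<Sum>j<n. c j * v j i) = 0) \<longrightarrow> (\<forall>j<n. c j = 0))}"

definition frame_span :: "nat \<Rightarrow> (nat \<Rightarrow> cvec) \<Rightarrow> cvec set" where
  "frame_span n v = {(\<lambda>i. \<Sum>j<n. c j * v j i) | c. True}"

definition Gr_fin :: "nat \<Rightarrow> nat \<Rightarrow> cvec set topology" where
  "Gr_fin n k = quotient_topology (stiefel n k) (frame_span n)"

definition Gr :: "nat \<Rightarrow> cvec set topology" where
  "Gr n = colimit_topology (Gr_fin n)"

section \<open>Complex vector bundles\<close>

record ('a, 'e) cbundle =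
  total_space :: "'e topology"
  bproj :: "'e \<Rightarrow> 'a"
  badd :: "'e \<Rightarrow> 'e \<Rightarrow> 'e"
  bscale :: "complex \<Rightarrow> 'e \<Rightarrow> 'e"

definition fibre :: "('a, 'e) cbundle \<Rightarrow> 'a \<Rightarrow> 'e set" where
  "fibre E x = {e \<in> topspace (total_space E). bproj E e = x}"

definition cvector_space_on ::
  "'v set \<Rightarrow> ('v \<Rightarrow> 'v \<Rightarrow> 'v) \<Rightarrow> (complex \<Rightarrow> 'v \<Rightarrow> 'v) \<Rightarrow> bool" where
  "cvector_space_on V vplus vscale \<longleftrightarrow>
     (\<exists>z. comm_group \<lparr>carrier = V, monoid.mult = vplus, one = z\<rparr>) \<and>
     (\<forall>c. \<forall>v\<in>V. vscale c v \<in> V) \<and>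
     (\<forall>v\<in>V. vscale 1 v = v) \<and>
     (\<forall>c d. \<forall>v\<in>V. vscale (c * d) v = vscale c (vscale d v)) \<and>
     (\<forall>c d. \<forall>v\<in>V. vscale (c + d) v = vplus (vscale c v) (vscale d v)) \<and>
     (\<forall>c. \<forall>v\<in>V. \<forall>w\<in>V. vscale c (vplus v w) = vplus (vscale c v) (vscale c w))"

definition local_trivialization ::
  "nat \<Rightarrow> 'a topology \<Rightarrow> ('a, 'e) cbundle \<Rightarrow> 'a set \<Rightarrow> ('a \<times> cvec \<Rightarrow> 'e) \<Rightarrow> bool" where
  "local_trivialization n X E U h \<longleftrightarrow>
     homeomorphic_map (prod_topology (subtopology X U) (cspace n))
       (subtopology (total_space E) {e. bproj E e \<in> U}) h \<and>
     (\<forall>y\<in>U. \<forall>v\<in>topspace (cspace n). bproj E (h (y, v)) = y) \<and>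
     (\<forall>y\<in>U. \<forall>v\<in>topspace (cspace n). \<forall>w\<in>topspace (cspace n).
        h (y, cvec_add v w) = badd E (h (y, v)) (h (y, w))) \<and>
     (\<forall>y\<in>U. \<forall>c. \<forall>v\<in>topspace (cspace n). h (y, cvec_scale c v) = bscale E c (h (y, v)))"

definition vector_bundle :: "nat \<Rightarrow> 'a topology \<Rightarrow> ('a, 'e) cbundle \<Rightarrow> bool" where
  "vector_bundle n X E \<longleftrightarrow>
     continuous_map (total_space E) X (bproj E) \<and>
     (\<forall>x\<in>topspace X. cvector_space_on (fibre E x) (badd E) (bscale E)) \<and>
     (\<forall>x\<in>topspace X. \<exists>U h. openin X U \<and> x \<in> U \<and> local_trivialization n X E U h)"

definition bundle_iso :: "('a, 'e) cbundle \<Rightarrow> ('a, 'f) cbundle \<Rightarrow> bool" where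
  "bundle_iso E F \<longleftrightarrow>
     (\<exists>\<phi>. homeomorphic_map (total_space E) (total_space F) \<phi> \<and>
        (\<forall>e\<in>topspace (total_space E). bproj F (\<phi> e) = bproj E e) \<and>
        (\<forall>e\<in>topspace (total_space E). \<forall>e'\<in>topspace (total_space E).
           bproj E e = bproj E e' \<longrightarrow> \<phi> (badd E e e') = badd F (\<phi> e) (\<phi> e')) \<and>
        (\<forall>c. \<forall>e\<in>topspace (total_space E). \<phi> (bscale E c e) = bscale F c (\<phi> e)))"

definition pullback_bundle ::
  "'a topology \<Rightarrow> ('a \<Rightarrow> 'b) \<Rightarrow> ('b, 'e) cbundle \<Rightarrow> ('a, 'a \<times> 'e) cbundle" where
  "pullback_bundle X f E = \<lparr>
     total_space = subtopology (prod_topology X (total_space E)) {(x, e). f x = bproj E e},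
     bproj = fst,
     badd = (\<lambda>(x, e) (x', e'). (x, badd E e e')),
     bscale = (\<lambda>c (x, e). (x, bscale E c e))\<rparr>"

definition univ_bundle :: "nat \<Rightarrow> (cvec set, cvec set \<times> cvec) cbundle" where
  "univ_bundle n = \<lparr>
     total_space = subtopology (prod_topology (Gr n) cspace_inf) {(V, v). v \<in> V},
     bproj = fst,
     badd = (\<lambda>(V, v) (V', v'). (V, cvec_add v v')),
     bscale = (\<lambda>c (V, v). (V, cvec_scale c v))\<rparr>"

text \<open>HOL has no type of all sets, so isomorphism classes are formed among bundles whose total
  space lives in the type below, that of the total spaces of pullbacks of the universal
  bundle.  This loses nothing: a rank \<open>n\<close> bundle over \<open>X\<close> is fibrewise in bijection with
  \<open>X \<times> \<complex>\<^sup>n\<close>, which embeds in this type, so by transport of structure it is isomorphic to such a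
  bundle.  The class \<open>vect_class n X E\<close> is defined for a bundle \<open>E\<close> with an arbitrary type of
  total space.\<close>

type_synonym 'a vbundle = "('a, 'a \<times> cvec set \<times> cvec) cbundle"

definition vect_class :: "nat \<Rightarrow> 'a topology \<Rightarrow> ('a, 'e) cbundle \<Rightarrow> 'a vbundle set" where
  "vect_class n X E = {B. vector_bundle n X B \<and> bundle_iso B E}"

definition Vect :: "nat \<Rightarrow> 'a topology \<Rightarrow> 'a vbundle set set" where
  "Vect n X = vect_class n X ` {B :: 'a vbundle. vector_bundle n X B}"

section \<open>Homotopy classes\<close>

definition hclass :: "'a topology \<Rightarrow> 'b topology \<Rightarrow> ('a \<Rightarrow> 'b) \<Rightarrow> ('a \<Rightarrow> 'b) set" where
  "hclass X Y f = {g. homotopic_with (\<lambda>_. True) X Y f g}"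

definition hclasses :: "'a topology \<Rightarrow> 'b topology \<Rightarrow> ('a \<Rightarrow> 'b) set set" where
  "hclasses X Y = hclass X Y ` {f. continuous_map X Y f}"

definition hcompose ::
  "'a topology \<Rightarrow> 'c topology \<Rightarrow> ('b \<Rightarrow> 'c) set \<Rightarrow> ('a \<Rightarrow> 'b) set \<Rightarrow> ('a \<Rightarrow> 'c) set" where
  "hcompose X Z c d = (\<Union>t\<in>c. \<Union>g\<in>d. hclass X Z (t \<circ> g))"

definition hleqL :: "'a topology \<Rightarrow> 'b topology \<Rightarrow> ('a \<Rightarrow> 'b) set \<Rightarrow> ('a \<Rightarrow> 'b) set \<Rightarrow> bool" where
  "hleqL X Y a b \<longleftrightarrow> (\<exists>c\<in>hclasses Y Y. a = hcompose X Y c b)"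

section \<open>Integral singular cohomology\<close>

text \<open>Elements of the total cochain group \<open>C\<^sup>*(X; \<int>) = \<Ovplus>\<^sub>p C\<^sup>p(X; \<int>)\<close>: \<open>c p\<close> is the component in
  degree \<open>p\<close>, a function on the singular \<open>p\<close>-simplices, set to \<open>0\<close> elsewhere.\<close>

type_synonym 'a cochain = "nat \<Rightarrow> ((nat \<Rightarrow> real) \<Rightarrow> 'a) \<Rightarrow> int"

definition cochains :: "'a topology \<Rightarrow> 'a cochain set" where
  "cochains X = {c. finite {p. c p \<noteq> (\<lambda>_. 0)} \<and>
                    (\<forall>p \<sigma>. \<not> singular_simplex p X \<sigma> \<longrightarrow> c p \<sigma> = 0)}"

text \<open>The dual of \<^const>\<open>chain_boundary\<close>.\<close>

definition coboundary :: "'a topology \<Rightarrow> 'a cochain \<Rightarrow> 'a cochain" where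
  "coboundary X c = (\<lambda>p \<sigma>. if 0 < p \<and> singular_simplex p X \<sigma>
     then \<Sum>k\<le>p. (- 1) ^ k * c (p - 1) (singular_face p k \<sigma>) else 0)"

definition front_face :: "nat \<Rightarrow> ((nat \<Rightarrow> real) \<Rightarrow> 'a) \<Rightarrow> (nat \<Rightarrow> real) \<Rightarrow> 'a" where
  "front_face p \<sigma> = restrict \<sigma> (standard_simplex p)"

text \<open>The face of a \<open>(p + q)\<close>-simplex spanned by the last \<open>q + 1\<close> vertices.\<close>

definition back_face :: "nat \<Rightarrow> nat \<Rightarrow> ((nat \<Rightarrow> real) \<Rightarrow> 'a) \<Rightarrow> (nat \<Rightarrow> real) \<Rightarrow> 'a" where
  "back_face p q \<sigma> =
     restrict (\<lambda>x. \<sigma> (\<lambda>i. if i < p then 0 else x (i - p))) (standard_simplex q)"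

definition cup :: "'a topology \<Rightarrow> 'a cochain \<Rightarrow> 'a cochain \<Rightarrow> 'a cochain" where
  "cup X c d = (\<lambda>m \<sigma>. if singular_simplex m X \<sigma>
     then \<Sum>p\<le>m. c p (front_face p \<sigma>) * d (m - p) (back_face p (m - p) \<sigma>) else 0)"

definition cocycle_ring :: "'a topology \<Rightarrow> 'a cochain ring" where
  "cocycle_ring X = \<lparr>
     carrier = {c \<in> cochains X. coboundary X c = (\<lambda>p \<sigma>. 0)},
     monoid.mult = cup X,
     one = (\<lambda>p \<sigma>. if p = 0 \<and> singular_simplex 0 X \<sigma> then 1 else 0),
     zero = (\<lambda>p \<sigma>. 0),
     add = (\<lambda>c d p \<sigma>. c p \<sigma> + d p \<sigma>)\<rparr>"

definition cohomology_ring :: "'a topology \<Rightarrow> 'a cochain set ring" where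
  "cohomology_ring X = cocycle_ring X Quot (coboundary X ` cochains X)"

definition cochain_map ::
  "'a topology \<Rightarrow> ('a \<Rightarrow> 'b) \<Rightarrow> 'b cochain \<Rightarrow> 'a cochain" where
  "cochain_map X f c =
     (\<lambda>p \<sigma>. if singular_simplex p X \<sigma> then c p (simplex_map p f \<sigma>) else 0)"

definition cohom_induced ::
  "'a topology \<Rightarrow> ('a \<Rightarrow> 'b) \<Rightarrow> 'b cochain set \<Rightarrow> 'a cochain set" where
  "cohom_induced X f A =
     (\<Union>c\<in>A. (coboundary X ` cochains X) +>\<^bsub>cocycle_ring X\<^esub> cochain_map X f c)"

section \<open>Characteristic classes and the order on \<open>Vect\<close>\<close>

definition is_classifying_map ::
  "nat \<Rightarrow> 'a topology \<Rightarrow> ('a, 'e) cbundle \<Rightarrow> ('a \<Rightarrow> cvec set) \<Rightarrow> bool" where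
  "is_classifying_map n X E f \<longleftrightarrow>
     continuous_map X (Gr n) f \<and> bundle_iso E (pullback_bundle X f (univ_bundle n))"

definition classifying_map ::
  "nat \<Rightarrow> 'a topology \<Rightarrow> ('a, 'e) cbundle \<Rightarrow> 'a \<Rightarrow> cvec set" where
  "classifying_map n X E = (SOME f. is_classifying_map n X E f)"

definition char_classes :: "nat \<Rightarrow> 'a topology \<Rightarrow> ('a, 'e) cbundle \<Rightarrow> 'a cochain set set" where
  "char_classes n X E = {cohom_induced X (classifying_map n X E) \<alpha> | \<alpha>.
                   \<alpha> \<in> carrier (cohomology_ring (Gr n))}"

definition vect_leqL :: "nat \<Rightarrow> 'a topology \<Rightarrow> 'a vbundle set \<Rightarrow> 'a vbundle set \<Rightarrow> bool" where
  "vect_leqL n X a b \<longleftrightarrow>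
     (\<exists>E\<in>a. \<exists>F\<in>b. hleqL X (Gr n) (hclass X (Gr n) (classifying_map n X E))
                                 (hclass X (Gr n) (classifying_map n X F)))"

definition vect_simL :: "nat \<Rightarrow> 'a topology \<Rightarrow> 'a vbundle set \<Rightarrow> 'a vbundle set \<Rightarrow> bool" where
  "vect_simL n X a b \<longleftrightarrow> vect_leqL n X a b \<and> vect_leqL n X b a"

text \<open>The image for one chosen representative; that any other representative and any other
  classifying map give the same subgroup is the well-definedness of the map, not part of
  this definition.\<close>

definition Im_H :: "nat \<Rightarrow> 'a topology \<Rightarrow> 'a vbundle set \<Rightarrow> 'a cochain set set" where
  "Im_H n X a = cohom_induced X (classifying_map n X (SOME E. E \<in> a)) `
                  carrier (cohomology_ring (Gr n))"

definition Sub :: "('g, 'm) monoid_scheme \<Rightarrow> 'g set set" where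
  "Sub G = {K. subgroup K G}"

end

theory Submission
  imports Defs
begin

text \<open>
  Characteristic classes of \<open>E\<close> are the pullbacks \<open>f\<^sub>E\<^sup>* \<alpha>\<close> along a classifying map. If
  \<open>[f\<^sub>E] = [t] \<circ> [f\<^sub>F]\<close> for a self-map \<open>t\<close> of the Grassmannian, then
  \<open>f\<^sub>E\<^sup>* \<alpha> = f\<^sub>F\<^sup>* (t\<^sup>* \<alpha>)\<close>, and therefore every characteristic class of \<open>E\<close> is one of \<open>F\<close>
  (\<open>cohom_induced_image_mono\<close>). The argument uses functoriality (\<open>cohom_induced_compose\<close>) and
  homotopy invariance (\<open>cohom_induced_homotopic\<close>) of singular cohomology.

  Homotopy invariance is the substantial part. It follows by duality from a chain homotopy
  between the chain maps of homotopic maps (\<open>homotopic_imp_chain_homotopy\<close>), obtained here by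
  acyclic models: the prism over the identity simplex of \<open>\<Delta>\<^sup>q\<close> is chosen by recursion on \<open>q\<close>,
  each time as a chain filling a cycle in the contractible cylinder \<open>[0,1] \<times> \<Delta>\<^sup>q\<close>
  (\<open>model_prism_Suc\<close>), and is then carried to all simplices by naturality
  (\<open>chain_boundary_prism\<close>). The induced map is a homomorphism of additive groups
  (\<open>cohom_induced_hom\<close>), which makes its image a subgroup.

  That the image depends only on the isomorphism class rests on the classification hypothesis.
  Isomorphic bundles have homotopic classifying maps because \<open>\<Phi>\<close> is injective
  (\<open>classifying_maps_hclass_eq\<close>), and every bundle has a classifying map because \<open>\<Phi>\<close> is
  surjective (\<open>classifying_map_exists\<close>). For a bundle with an arbitrary type of total space this
  also requires an isomorphic copy within the fixed type of representatives
  (\<open>vector_bundle_representative\<close>).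
\<close>

section \<open>Chain homotopies between homotopic maps\<close>

text \<open>The identity is homotopic to a constant map, so a cycle is homologous to its image under
  that map, a cycle in a one-point space. Such a cycle bounds in positive degrees.\<close>

lemma contractible_cycle_imp_boundary:
  assumes "contractible_space X" "1 \<le> p" "singular_relcycle p X {} c"
  shows "singular_relboundary p X {} c"
proof (cases "X = trivial_topology")
  case True
  then have "c = 0"
    using assms(3) by (simp add: singular_cycle singular_chain_empty)
  then show ?thesis
    by simp
next
  case False
  then obtain a where a: "a \<in> topspace X" "homotopic_with (\<lambda>x. True) X X id (\<lambda>x. a)"
    using assms(1) by (auto simp: contractible_space)
  have "homologous_rel p X {} (chain_map p id c) (chain_map p (\<lambda>x. a) c)"
    using homotopic_imp_homologous_rel_chain_maps [of "{}" "{}"] a(2) assms(3) by fastforce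
  moreover have "chain_map p id c = c"
    using assms(3) chain_map_ident [of p X c] by (simp add: singular_cycle)
  moreover have "singular_relboundary p X {} (chain_map p (\<lambda>x. a) c)"
  proof -
    have "singular_relcycle p (subtopology X {a}) {} (chain_map p (\<lambda>x. a) c)"
      by (rule singular_relcycle_chain_map [OF assms(3)]) (auto simp: continuous_map_in_subtopology a(1))
    moreover have "topspace (subtopology X {a}) = {a}"
      using a(1) by auto
    ultimately have "singular_relboundary p (subtopology X {a}) {} (chain_map p (\<lambda>x. a) c)"
      using singular_boundary_eq_cycle_singleton [OF _ assms(2)] by metis
    then show ?thesis
      using singular_boundary_mono [of "{a}" UNIV p X "chain_map p (\<lambda>x. a) c"] by simp
  qed
  ultimately show ?thesis
    unfolding homologous_rel_def
    by (metis diff_add_cancel singular_relboundary_add)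
qed

abbreviation simplex_space :: "nat \<Rightarrow> (nat \<Rightarrow> real) topology" where
  "simplex_space q \<equiv> subtopology (powertop_real UNIV) (standard_simplex q)"

abbreviation cylinder :: "'a topology \<Rightarrow> (real \<times> 'a) topology" where
  "cylinder X \<equiv> prod_topology (top_of_set {0..1}) X"

abbreviation identity_simplex :: "nat \<Rightarrow> (nat \<Rightarrow> real) chain" where
  "identity_simplex q \<equiv> frag_of (restrict id (standard_simplex q))"

text \<open>The straight-line homotopy to the vertex with index 0.\<close>

lemma contractible_simplex_space: "contractible_space (simplex_space q)"
proof -
  let ?a = "\<lambda>j. if j = 0 then 1 else (0::real)"
  let ?h = "\<lambda>z i. (1 - fst z) * snd z i + fst z * ?a i"
  have a: "?a \<in> standard_simplex q"
    by simp
  have "continuous_map (cylinder (simplex_space q)) euclideanreal (\<lambda>z. ?h z i)" for i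
  proof -
    have s: "continuous_map (cylinder (simplex_space q)) euclideanreal (\<lambda>z. snd z i)"
    proof -
      have "continuous_map (cylinder (simplex_space q)) (powertop_real UNIV) snd"
        using continuous_map_snd continuous_map_into_fulltopology by blast
      then show ?thesis
        by (simp add: continuous_map_componentwise_UNIV)
    qed
    have f: "continuous_map (cylinder (simplex_space q)) euclideanreal fst"
      using continuous_map_fst continuous_map_into_fulltopology by blast
    show ?thesis
      by (intro continuous_map_add continuous_map_real_mult continuous_map_diff s f) auto
  qed
  then have "continuous_map (cylinder (simplex_space q)) (powertop_real UNIV) ?h"
    by (simp add: continuous_map_componentwise_UNIV)
  moreover have "?h z \<in> standard_simplex q" if "z \<in> topspace (cylinder (simplex_space q))" for z
    using that a by (intro convex_standard_simplex) auto
  ultimately have "continuous_map (cylinder (simplex_space q)) (simplex_space q) ?h"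
    by (auto simp: continuous_map_in_subtopology)
  then have "homotopic_with (\<lambda>x. True) (simplex_space q) (simplex_space q) id (\<lambda>x. ?a)"
    unfolding homotopic_with_def by (intro exI [of _ ?h]) auto
  then show ?thesis
    unfolding contractible_space_def by blast
qed

lemma contractible_cylinder:
  "contractible_space X \<Longrightarrow> contractible_space (cylinder X)"
  by (simp add: contractible_space_prod_topology convex_imp_contractible is_interval_convex_1)

lemma singular_chain_identity_simplex: "singular_chain q (simplex_space q) (identity_simplex q)"
  by (simp add: singular_chain_of singular_simplex_def)

text \<open>A chain \<open>D\<close> on the model cylinder \<open>[0,1] \<times> \<Delta>\<^sup>q\<close> determines a degree-raising homomorphism on the
  chains of every space, by pushing \<open>D\<close> forward along \<open>id \<times> \<sigma>\<close> for each simplex \<open>\<sigma>\<close>. Naturality in the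
  space is thereby built in.\<close>

definition prism :: "nat \<Rightarrow> (real \<times> (nat \<Rightarrow> real)) chain \<Rightarrow> 'a chain \<Rightarrow> (real \<times> 'a) chain" where
  "prism q D c = frag_extend (\<lambda>\<sigma>. chain_map (Suc q) (map_prod id \<sigma>) D) c"

text \<open>The chain homotopy identity at the one simplex where it has to be checked, the identity of
  \<open>\<Delta>\<^sup>q\<close>: the boundary of the prism is top minus bottom minus the prism over the boundary. The
  chain \<open>D'\<close> is the model in degree \<open>q - 1\<close>; for \<open>q = 0\<close> the last term is 0.\<close>

definition model_prism ::
  "nat \<Rightarrow> (real \<times> (nat \<Rightarrow> real)) chain \<Rightarrow> (real \<times> (nat \<Rightarrow> real)) chain \<Rightarrow> bool" where
  "model_prism q D' D \<longleftrightarrow>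
     singular_chain (Suc q) (cylinder (simplex_space q)) D \<and>
     chain_boundary (Suc q) D =
       chain_map q (Pair 1) (identity_simplex q) - chain_map q (Pair 0) (identity_simplex q)
       - prism (q - 1) D' (chain_boundary q (identity_simplex q))"

lemma prism_diff: "prism q D (a - b) = prism q D a - prism q D b"
  by (simp add: prism_def frag_extend_diff)

lemma prism_0 [simp]: "prism q D 0 = 0"
  by (simp add: prism_def)

lemma singular_chain_prism:
  assumes "singular_chain (Suc q) (cylinder (simplex_space q)) D" "singular_chain q X c"
  shows "singular_chain (Suc q) (cylinder X) (prism q D c)"
  unfolding prism_def
proof (intro singular_chain_extend singular_chain_chain_map [OF assms(1)])
  fix \<sigma> assume "\<sigma> \<in> Poly_Mapping.keys c"
  then have "continuous_map (simplex_space q) X \<sigma>"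
    using assms(2) by (auto simp: singular_chain_def singular_simplex_def)
  then show "continuous_map (cylinder (simplex_space q)) (cylinder X) (map_prod id \<sigma>)"
    using continuous_map_compose [OF continuous_map_snd]
    by (simp add: map_prod_def case_prod_unfold continuous_map_pairwise o_def continuous_map_fst)
qed

lemma chain_map_prism:
  assumes "singular_chain (Suc q) (cylinder (simplex_space q)) D"
  shows "chain_map (Suc q) (map_prod id g) (prism q D c) = prism q D (chain_map q g c)"
  using subset_UNIV
proof (induction c rule: frag_induction)
  case (one \<sigma>)
  have "chain_map (Suc q) (map_prod id g) (chain_map (Suc q) (map_prod id \<sigma>) D) =
        chain_map (Suc q) (map_prod id g \<circ> map_prod id \<sigma>) D"
    by (simp add: chain_map_compose)
  also have "\<dots> = chain_map (Suc q) (map_prod id (simplex_map q g \<sigma>)) D"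
    using assms by (rule chain_map_eq) (auto simp: simplex_map_def)
  finally show ?case
    unfolding prism_def frag_extend_of chain_map_of .
qed (auto simp: prism_diff chain_map_diff)

text \<open>Every singular simplex \<open>\<sigma>\<close> is the image of the identity simplex under \<open>\<sigma>\<close>, so the identity
  imposed on the models spreads to all chains of all spaces by naturality.\<close>

lemma chain_boundary_prism:
  assumes D: "model_prism q D' D"
    and D': "q > 0 \<Longrightarrow> singular_chain q (cylinder (simplex_space (q - 1))) D'"
    and c: "singular_chain q X c"
  shows "chain_boundary (Suc q) (prism q D c) =
    chain_map q (Pair 1) c - chain_map q (Pair 0) c - prism (q - 1) D' (chain_boundary q c)"
  using c unfolding singular_chain_def
proof (induction c rule: frag_induction)
  case (one \<sigma>)
  then have \<sigma>: "chain_map q \<sigma> (identity_simplex q) = frag_of \<sigma>"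
    using singular_simplex_chain_map_id by blast
  have ends: "chain_map q (map_prod id \<sigma>) (chain_map q (Pair t) (identity_simplex q)) =
      chain_map q (Pair t) (frag_of \<sigma>)" for t
  proof -
    have "map_prod id \<sigma> \<circ> Pair t = Pair t \<circ> \<sigma>"
      by auto
    then show ?thesis
      by (metis \<sigma> chain_map_compose comp_apply)
  qed
  have side: "chain_map q (map_prod id \<sigma>) (prism (q - 1) D' (chain_boundary q (identity_simplex q)))
      = prism (q - 1) D' (chain_boundary q (frag_of \<sigma>))"
  proof (cases "q = 0")
    case True
    then show ?thesis
      by (simp add: chain_boundary_def)
  next
    case False
    then have "chain_map q (map_prod id \<sigma>) (prism (q - 1) D' (chain_boundary q (identity_simplex q)))
      = prism (q - 1) D' (chain_map (q - 1) \<sigma> (chain_boundary q (identity_simplex q)))"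
      using chain_map_prism [of "q - 1" D' \<sigma>] D' by simp
    also have "\<dots> = prism (q - 1) D' (chain_boundary q (chain_map q \<sigma> (identity_simplex q)))"
      using chain_boundary_chain_map [OF singular_chain_identity_simplex, of q \<sigma>] by simp
    finally show ?thesis
      by (simp only: \<sigma>)
  qed
  have "chain_boundary (Suc q) (prism q D (frag_of \<sigma>)) =
        chain_map q (map_prod id \<sigma>) (chain_boundary (Suc q) D)"
    using D chain_boundary_chain_map [of "Suc q" "cylinder (simplex_space q)" D "map_prod id \<sigma>"]
    unfolding model_prism_def by (simp add: prism_def del: chain_map_of)
  also have "\<dots> = chain_map q (Pair 1) (frag_of \<sigma>) - chain_map q (Pair 0) (frag_of \<sigma>)
      - prism (q - 1) D' (chain_boundary q (frag_of \<sigma>))"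
    using D unfolding model_prism_def by (simp only: chain_map_diff ends side)
  finally show ?case .
next
  case (diff a b)
  then show ?case
    by (simp add: prism_diff chain_boundary_diff chain_map_diff)
qed (simp add: chain_boundary_def)

lemma continuous_map_Pair_const:
  "t \<in> {0..1} \<Longrightarrow> continuous_map X (cylinder X) (Pair t)"
  by (simp add: continuous_map_pairwise o_def)

text \<open>The prescribed boundary of the next model is a cycle: the chain homotopy identity one
  degree lower, applied to the boundary of the identity simplex, makes all terms cancel. The
  cylinder over a simplex is contractible, so this cycle bounds.\<close>

lemma model_prism_Suc:
  assumes D: "model_prism q D' D"
    and D': "q > 0 \<Longrightarrow> singular_chain q (cylinder (simplex_space (q - 1))) D'"
  shows "\<exists>E. model_prism (Suc q) D E"
proof -
  let ?\<iota> = "identity_simplex (Suc q)"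
  let ?M = "cylinder (simplex_space (Suc q))"
  let ?b = "chain_map (Suc q) (Pair 1) ?\<iota> - chain_map (Suc q) (Pair 0) ?\<iota>
            - prism q D (chain_boundary (Suc q) ?\<iota>)"
  note \<iota> = singular_chain_identity_simplex [of "Suc q"]
  have d\<iota>: "singular_chain q (simplex_space (Suc q)) (chain_boundary (Suc q) ?\<iota>)"
    using singular_chain_boundary_alt [OF \<iota>] .
  have "singular_chain (Suc q) ?M ?b"
    using D unfolding model_prism_def
    by (intro singular_chain_diff singular_chain_prism d\<iota>
        singular_chain_chain_map [OF \<iota>] continuous_map_Pair_const) auto
  moreover have "chain_boundary (Suc q) ?b = 0"
  proof -
    have "chain_boundary q (chain_boundary (Suc q) ?\<iota>) = 0"
      using chain_boundary_boundary [OF \<iota>] by simp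
    moreover have "chain_boundary (Suc q) (chain_map (Suc q) (Pair t) ?\<iota>) =
        chain_map q (Pair t) (chain_boundary (Suc q) ?\<iota>)" for t :: real
      using chain_boundary_chain_map [OF \<iota>, of "Pair t"] by simp
    ultimately show ?thesis
      using chain_boundary_prism [OF D D' d\<iota>] by (simp add: chain_boundary_diff del: chain_map_of)
  qed
  ultimately have "singular_relboundary (Suc q) ?M {} ?b"
    by (intro contractible_cycle_imp_boundary contractible_cylinder contractible_simplex_space)
       (auto simp: singular_cycle)
  then show ?thesis
    by (auto simp: singular_boundary model_prism_def)
qed

text \<open>Cycles of degree 0 in a contractible space need not bound. The difference of the two end
  points does, as the two inclusions of a point into the cylinder are homotopic.\<close>

lemma model_prism_0: "\<exists>E. model_prism 0 0 E"
proof -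
  let ?M = "cylinder (simplex_space 0)"
  have "homotopic_with (\<lambda>h. True) (simplex_space 0) ?M (Pair 1) (Pair 0)"
    by (intro homotopic_into_contractible_space conjI contractible_cylinder
        contractible_simplex_space continuous_map_Pair_const) auto
  then have "homologous_rel 0 ?M {} (chain_map 0 (Pair 1) (identity_simplex 0))
      (chain_map 0 (Pair 0) (identity_simplex 0))"
    using homotopic_imp_homologous_rel_chain_maps [of "{}" "{}"]
      singular_chain_identity_simplex [of 0]
    by (fastforce simp: singular_cycle chain_boundary_def)
  then show ?thesis
    by (auto simp: homologous_rel_def singular_boundary model_prism_def chain_boundary_def)
qed

lemma model_prisms_exist: "\<exists>D. \<forall>q. model_prism q (D (q - 1)) (D q)"
proof -
  have "\<exists>D. \<forall>q. (\<exists>E. model_prism q E (D q) \<and>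
          (q > 0 \<longrightarrow> singular_chain q (cylinder (simplex_space (q - 1))) E)) \<and>
          model_prism (Suc q) (D q) (D (Suc q))"
  proof (rule dependent_nat_choice)
    show "\<exists>x E. model_prism 0 E x \<and>
        (0 < (0::nat) \<longrightarrow> singular_chain 0 (cylinder (simplex_space (0 - 1))) E)"
      using model_prism_0 by auto
  next
    fix x q
    assume "\<exists>E. model_prism q E x \<and>
          (q > 0 \<longrightarrow> singular_chain q (cylinder (simplex_space (q - 1))) E)"
    then obtain y where y: "model_prism (Suc q) x y"
        and x: "singular_chain (Suc q) (cylinder (simplex_space q)) x"
      using model_prism_Suc model_prism_def by blast
    then show "\<exists>y. (\<exists>E. model_prism (Suc q) E y \<and>
          (Suc q > 0 \<longrightarrow> singular_chain (Suc q) (cylinder (simplex_space (Suc q - 1))) E)) \<and>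
          model_prism (Suc q) x y"
      by auto
  qed
  then obtain D where D0: "\<exists>E. model_prism 0 E (D 0)"
      and DS: "\<And>q. model_prism (Suc q) (D q) (D (Suc q))"
    by blast
  have "model_prism q (D (q - 1)) (D q)" for q
  proof (cases q)
    case 0
    then show ?thesis
      using D0 by (simp add: model_prism_def chain_boundary_def)
  next
    case (Suc r)
    then show ?thesis
      using DS by simp
  qed
  then show ?thesis
    by blast
qed

text \<open>The prism operators, followed by the homotopy on the cylinder. A statement about homology
  classes alone would not dualize to cohomology: the operator itself is needed at the level of
  chains.\<close>

theorem homotopic_imp_chain_homotopy:
  assumes "homotopic_with (\<lambda>_. True) X Y f g"
  obtains P where "\<And>q c. singular_chain q X c \<Longrightarrow> singular_chain (Suc q) Y (P q c)"
    and "\<And>q a b. P q (a - b) = P q a - P q b"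
    and "\<And>q c. singular_chain q X c \<Longrightarrow> chain_boundary (Suc q) (P q c) =
           chain_map q g c - chain_map q f c - P (q - 1) (chain_boundary q c)"
proof -
  obtain h where h: "continuous_map (cylinder X) Y h"
    and h0: "\<And>x. h (0, x) = f x" and h1: "\<And>x. h (1, x) = g x"
    using assms by (auto simp: homotopic_with_def)
  obtain D where D: "\<And>q. model_prism q (D (q - 1)) (D q)"
    using model_prisms_exist by blast
  have D_chain: "\<And>q. singular_chain (Suc q) (cylinder (simplex_space q)) (D q)"
    using D by (auto simp: model_prism_def)
  define P where "P = (\<lambda>q c. chain_map (Suc q) h (prism q (D q) c))"
  show thesis
  proof
    show "singular_chain (Suc q) Y (P q c)" if "singular_chain q X c" for q c
      unfolding P_def by (intro singular_chain_chain_map [OF _ h] singular_chain_prism [OF D_chain that])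
    show "P q (a - b) = P q a - P q b" for q a b
      by (simp add: P_def prism_diff chain_map_diff)
    show "chain_boundary (Suc q) (P q c) =
           chain_map q g c - chain_map q f c - P (q - 1) (chain_boundary q c)"
      if c: "singular_chain q X c" for q c
    proof -
      have "chain_boundary (Suc q) (P q c) = chain_map q h (chain_boundary (Suc q) (prism q (D q) c))"
        unfolding P_def
        using chain_boundary_chain_map [OF singular_chain_prism [OF D_chain c]] by simp
      also have "\<dots> = chain_map q h (chain_map q (Pair 1) c) - chain_map q h (chain_map q (Pair 0) c)
          - chain_map q h (prism (q - 1) (D (q - 1)) (chain_boundary q c))"
        using chain_boundary_prism [OF D _ c] D_chain
        by (metis Suc_diff_1 chain_map_diff)
      also have "chain_map q h (chain_map q (Pair 1) c) = chain_map q g c"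
        by (metis chain_map_compose comp_apply h1 ext)
      also have "chain_map q h (chain_map q (Pair 0) c) = chain_map q f c"
        by (metis chain_map_compose comp_apply h0 ext)
      also have "chain_map q h (prism (q - 1) (D (q - 1)) (chain_boundary q c)) =
          P (q - 1) (chain_boundary q c)"
        by (cases "q = 0") (simp_all add: P_def chain_boundary_def)
      finally show ?thesis .
    qed
  qed
qed

section \<open>Cochains and the cohomology group\<close>

text \<open>The pairing of cochains with chains turns each identity for cochain operators into the
  dual identity for chains. It acts on a single degree of a cochain.\<close>

definition cochain_eval :: "(((nat \<Rightarrow> real) \<Rightarrow> 'a) \<Rightarrow> int) \<Rightarrow> 'a chain \<Rightarrow> int" where
  "cochain_eval \<phi> x = (\<Sum>\<sigma>\<in>Poly_Mapping.keys x. Poly_Mapping.lookup x \<sigma> * \<phi> \<sigma>)"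

lemma cochain_eval_superset:
  "finite S \<Longrightarrow> Poly_Mapping.keys x \<subseteq> S \<Longrightarrow>
     cochain_eval \<phi> x = (\<Sum>\<sigma>\<in>S. Poly_Mapping.lookup x \<sigma> * \<phi> \<sigma>)"
  unfolding cochain_eval_def by (rule sum.mono_neutral_left) (auto simp: in_keys_iff)

lemma cochain_eval_of [simp]: "cochain_eval \<phi> (frag_of \<sigma>) = \<phi> \<sigma>"
  by (simp add: cochain_eval_def)

lemma cochain_eval_0 [simp]: "cochain_eval \<phi> 0 = 0"
  by (simp add: cochain_eval_def)

lemma cochain_eval_diff: "cochain_eval \<phi> (a - b) = cochain_eval \<phi> a - cochain_eval \<phi> b"
proof -
  let ?S = "Poly_Mapping.keys a \<union> Poly_Mapping.keys b"
  show ?thesis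
    using keys_diff [of a b]
    by (simp add: cochain_eval_superset [of ?S] lookup_minus left_diff_distrib sum_subtractf)
qed

text \<open>Additive functionals on chains are cochains. This is what lets an identity checked on
  generators be used on arbitrary chains, for instance on boundaries.\<close>

lemma additive_eq_cochain_eval:
  fixes \<Phi> :: "'a chain \<Rightarrow> int"
  assumes "\<And>a b. \<Phi> (a - b) = \<Phi> a - \<Phi> b"
  shows "\<Phi> x = cochain_eval (\<lambda>\<sigma>. \<Phi> (frag_of \<sigma>)) x"
  using subset_UNIV
proof (induction x rule: frag_induction)
  case zero
  show ?case
    using assms [of 0 0] by simp
qed (auto simp: assms cochain_eval_diff)

lemma cochain_eval_cong:
  assumes "singular_chain p X x" "\<And>\<sigma>. singular_simplex p X \<sigma> \<Longrightarrow> \<phi> \<sigma> = \<psi> \<sigma>"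
  shows "cochain_eval \<phi> x = cochain_eval \<psi> x"
  using assms unfolding cochain_eval_def singular_chain_def by (intro sum.cong) auto

lemma cochain_eval_cmul: "cochain_eval \<phi> (frag_cmul k a) = k * cochain_eval \<phi> a"
  by (simp add: cochain_eval_superset [of "Poly_Mapping.keys a"] keys_cmul sum_distrib_left mult.assoc)

lemma cochain_eval_sum: "cochain_eval \<phi> (sum a I) = (\<Sum>i\<in>I. cochain_eval \<phi> (a i))"
proof (induction I rule: infinite_finite_induct)
  case (insert i I)
  have "cochain_eval \<phi> (a i + sum a I) = cochain_eval \<phi> (a i) + cochain_eval \<phi> (sum a I)"
    using cochain_eval_diff [of \<phi> "a i + sum a I" "sum a I"] by simp
  with insert show ?case
    by simp
qed auto

lemma coboundary_eq_eval:
  "coboundary X c p \<sigma> = (if singular_simplex p X \<sigma>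
     then cochain_eval (c (p - 1)) (chain_boundary p (frag_of \<sigma>)) else 0)"
  by (simp add: coboundary_def chain_boundary_of cochain_eval_sum cochain_eval_cmul)

lemma cochain_eval_coboundary:
  assumes "singular_chain p X x"
  shows "cochain_eval (coboundary X c p) x = cochain_eval (c (p - 1)) (chain_boundary p x)"
proof -
  have "cochain_eval (c (p - 1)) (chain_boundary p x)
      = cochain_eval (\<lambda>\<sigma>. cochain_eval (c (p - 1)) (chain_boundary p (frag_of \<sigma>))) x"
    by (rule additive_eq_cochain_eval) (simp add: chain_boundary_diff cochain_eval_diff)
  also have "\<dots> = cochain_eval (coboundary X c p) x"
    using assms by (rule cochain_eval_cong) (simp add: coboundary_eq_eval)
  finally show ?thesis ..
qed

lemma cochain_eval_cochain_map:
  assumes "singular_chain p X x"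
  shows "cochain_eval (cochain_map X f c p) x = cochain_eval (c p) (chain_map p f x)"
proof -
  have "cochain_eval (c p) (chain_map p f x)
      = cochain_eval (\<lambda>\<sigma>. cochain_eval (c p) (chain_map p f (frag_of \<sigma>))) x"
    by (rule additive_eq_cochain_eval) (simp add: chain_map_diff cochain_eval_diff)
  also have "\<dots> = cochain_eval (cochain_map X f c p) x"
    using assms by (rule cochain_eval_cong) (simp add: cochain_map_def)
  finally show ?thesis ..
qed

lemma coboundary_in_cochains:
  assumes "c \<in> cochains X"
  shows "coboundary X c \<in> cochains X"
proof -
  have "{p. coboundary X c p \<noteq> (\<lambda>_. 0)} \<subseteq> Suc ` {p. c p \<noteq> (\<lambda>_. 0)}"
  proof
    fix p assume p: "p \<in> {p. coboundary X c p \<noteq> (\<lambda>_. 0)}"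
    have "coboundary X c p = (\<lambda>_. 0)" if "p = 0 \<or> c (p - 1) = (\<lambda>_. 0)"
      using that by (auto simp: coboundary_def)
    with p have "p \<noteq> 0 \<and> c (p - 1) \<noteq> (\<lambda>_. 0)"
      by auto
    then show "p \<in> Suc ` {p. c p \<noteq> (\<lambda>_. 0)}"
      by (intro image_eqI [of _ _ "p - 1"]) auto
  qed
  then show ?thesis
    using assms by (auto simp: cochains_def coboundary_def intro: finite_subset)
qed

lemma cochain_map_in_cochains:
  assumes "c \<in> cochains Y"
  shows "cochain_map X f c \<in> cochains X"
proof -
  have "{p. cochain_map X f c p \<noteq> (\<lambda>_. 0)} \<subseteq> {p. c p \<noteq> (\<lambda>_. 0)}"
    by (auto simp: cochain_map_def)
  then show ?thesis
    using assms by (auto simp: cochains_def cochain_map_def intro: finite_subset)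
qed

lemma coboundary_coboundary: "coboundary X (coboundary X c) = (\<lambda>p \<sigma>. 0)"
proof (intro ext)
  fix p \<sigma>
  show "coboundary X (coboundary X c) p \<sigma> = 0"
  proof (cases "singular_simplex p X \<sigma>")
    case True
    then have \<sigma>: "singular_chain p X (frag_of \<sigma>)"
      by (simp add: singular_chain_of)
    show ?thesis
      using chain_boundary_boundary [OF \<sigma>] singular_chain_boundary [OF \<sigma>]
      by (simp add: coboundary_eq_eval [of X "coboundary X c"] cochain_eval_coboundary)
  qed (simp add: coboundary_def)
qed

lemma coboundary_cochain_map:
  assumes "continuous_map X Y f"
  shows "coboundary X (cochain_map X f c) = cochain_map X f (coboundary Y c)"
proof (intro ext)
  fix p \<sigma>
  show "coboundary X (cochain_map X f c) p \<sigma> = cochain_map X f (coboundary Y c) p \<sigma>"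
  proof (cases "singular_simplex p X \<sigma>")
    case True
    then have \<sigma>: "singular_chain p X (frag_of \<sigma>)"
      by (simp add: singular_chain_of)
    have "coboundary X (cochain_map X f c) p \<sigma>
        = cochain_eval (c (p - 1)) (chain_map (p - 1) f (chain_boundary p (frag_of \<sigma>)))"
      using True singular_chain_boundary [OF \<sigma>]
      by (simp add: coboundary_eq_eval cochain_eval_cochain_map)
    also have "\<dots> = cochain_eval (c (p - 1)) (chain_boundary p (frag_of (simplex_map p f \<sigma>)))"
      using chain_boundary_chain_map [OF \<sigma>, of f] by simp
    also have "\<dots> = cochain_map X f (coboundary Y c) p \<sigma>"
      using True assms by (simp add: cochain_map_def coboundary_eq_eval singular_simplex_simplex_map)
    finally show ?thesis .
  qed (simp add: coboundary_def cochain_map_def)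
qed

abbreviation coboundaries :: "'a topology \<Rightarrow> 'a cochain set" where
  "coboundaries X \<equiv> coboundary X ` cochains X"

lemma cocycle_ring_simps:
  "z \<in> carrier (cocycle_ring X) \<longleftrightarrow> z \<in> cochains X \<and> coboundary X z = (\<lambda>p \<sigma>. 0)"
  "z \<oplus>\<^bsub>cocycle_ring X\<^esub> w = (\<lambda>p \<sigma>. z p \<sigma> + w p \<sigma>)"
  "\<zero>\<^bsub>cocycle_ring X\<^esub> = (\<lambda>p \<sigma>. 0)"
  by (auto simp: cocycle_ring_def)

lemma cochains_add:
  assumes "c \<in> cochains X" "d \<in> cochains X"
  shows "(\<lambda>p \<sigma>. c p \<sigma> + d p \<sigma>) \<in> cochains X"
proof -
  have "{p. (\<lambda>\<sigma>. c p \<sigma> + d p \<sigma>) \<noteq> (\<lambda>_. 0)} \<subseteq> {p. c p \<noteq> (\<lambda>_. 0)} \<union> {p. d p \<noteq> (\<lambda>_. 0)}"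
    by auto
  then show ?thesis
    using assms unfolding cochains_def by (auto intro: finite_subset)
qed

lemma cochains_minus: "c \<in> cochains X \<Longrightarrow> (\<lambda>p \<sigma>. - c p \<sigma>) \<in> cochains X"
  unfolding cochains_def by (simp add: fun_eq_iff)

lemma coboundary_add:
  "coboundary X (\<lambda>p \<sigma>. c p \<sigma> + d p \<sigma>) = (\<lambda>p \<sigma>. coboundary X c p \<sigma> + coboundary X d p \<sigma>)"
  by (simp add: coboundary_def fun_eq_iff sum.distrib distrib_left)

lemma coboundary_minus: "coboundary X (\<lambda>p \<sigma>. - c p \<sigma>) = (\<lambda>p \<sigma>. - coboundary X c p \<sigma>)"
  by (simp add: coboundary_def fun_eq_iff sum_negf)

lemma cochain_map_add:
  "cochain_map X f (\<lambda>p \<sigma>. c p \<sigma> + d p \<sigma>) =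
     (\<lambda>p \<sigma>. cochain_map X f c p \<sigma> + cochain_map X f d p \<sigma>)"
  by (simp add: cochain_map_def fun_eq_iff)

lemma abelian_group_cocycle_ring: "abelian_group (cocycle_ring X)"
proof (rule abelian_groupI)
  show "\<zero>\<^bsub>cocycle_ring X\<^esub> \<in> carrier (cocycle_ring X)"
    by (simp add: cocycle_ring_simps cochains_def coboundary_def fun_eq_iff)
  show "x \<oplus>\<^bsub>cocycle_ring X\<^esub> y \<in> carrier (cocycle_ring X)"
    if "x \<in> carrier (cocycle_ring X)" "y \<in> carrier (cocycle_ring X)" for x y
    using that by (simp add: cocycle_ring_simps cochains_add coboundary_add)
  show "\<exists>y\<in>carrier (cocycle_ring X). y \<oplus>\<^bsub>cocycle_ring X\<^esub> x = \<zero>\<^bsub>cocycle_ring X\<^esub>"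
    if "x \<in> carrier (cocycle_ring X)" for x
    using that by (intro bexI [of _ "\<lambda>p \<sigma>. - x p \<sigma>"])
      (simp_all add: cocycle_ring_simps cochains_minus coboundary_minus)
qed (simp_all add: cocycle_ring_simps add_ac)

lemma subgroup_coboundaries: "subgroup (coboundaries X) (add_monoid (cocycle_ring X))"
proof -
  interpret Z: abelian_group "cocycle_ring X"
    by (rule abelian_group_cocycle_ring)
  have sub: "coboundaries X \<subseteq> carrier (cocycle_ring X)"
    by (auto simp: cocycle_ring_simps coboundary_in_cochains coboundary_coboundary)
  show ?thesis
  proof (rule Z.add.subgroupI)
    show "coboundaries X \<subseteq> carrier (cocycle_ring X)"
      by (rule sub)
    have "(\<lambda>p \<sigma>. 0) \<in> cochains X"
      by (simp add: cochains_def)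
    then show "coboundaries X \<noteq> {}"
      by blast
    show "\<ominus>\<^bsub>cocycle_ring X\<^esub> b \<in> coboundaries X" if b: "b \<in> coboundaries X" for b
    proof -
      obtain c where c: "c \<in> cochains X" "b = coboundary X c"
        using b by blast
      have c': "coboundary X (\<lambda>p \<sigma>. - c p \<sigma>) \<in> coboundaries X"
        using c(1) by (intro imageI cochains_minus)
      have "\<ominus>\<^bsub>cocycle_ring X\<^esub> b = coboundary X (\<lambda>p \<sigma>. - c p \<sigma>)"
        using b c' sub c(2)
        by (intro Z.minus_equality) (auto simp: cocycle_ring_simps coboundary_minus)
      with c' show ?thesis
        by simp
    qed
    show "b \<oplus>\<^bsub>cocycle_ring X\<^esub> b' \<in> coboundaries X"
      if "b \<in> coboundaries X" "b' \<in> coboundaries X" for b b'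
      using that by (auto simp: cocycle_ring_simps simp flip: coboundary_add intro!: imageI cochains_add)
  qed
qed

lemma normal_coboundaries: "coboundaries X \<lhd> add_monoid (cocycle_ring X)"
  using abelian_group.a_comm_group [OF abelian_group_cocycle_ring] subgroup_coboundaries
  by (rule comm_group.normal_iff_subgroup [THEN iffD2])

lemma add_monoid_cohomology_ring:
  "add_monoid (cohomology_ring X) = add_monoid (cocycle_ring X) Mod coboundaries X"
  by (simp add: cohomology_ring_def FactRing_def FactGroup_def A_RCOSETS_def set_add_def)

lemma group_cohomology: "group (add_monoid (cohomology_ring X))"
  unfolding add_monoid_cohomology_ring by (rule normal.factorgroup_is_group [OF normal_coboundaries])

abbreviation cohomology_class :: "'a topology \<Rightarrow> 'a cochain \<Rightarrow> 'a cochain set" where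
  "cohomology_class X z \<equiv> coboundaries X +>\<^bsub>cocycle_ring X\<^esub> z"

lemma carrier_cohomology_ring:
  "carrier (cohomology_ring X) = cohomology_class X ` carrier (cocycle_ring X)"
  by (auto simp: cohomology_ring_def FactRing_def A_RCOSETS_def')

lemma add_cohomology_class:
  assumes "z \<in> carrier (cocycle_ring X)" "w \<in> carrier (cocycle_ring X)"
  shows "cohomology_class X z \<oplus>\<^bsub>cohomology_ring X\<^esub> cohomology_class X w =
    cohomology_class X (\<lambda>p \<sigma>. z p \<sigma> + w p \<sigma>)"
  using normal.rcos_sum [OF normal_coboundaries, of z X w] assms
  by (simp add: cohomology_ring_def FactRing_def set_add_def a_r_coset_def cocycle_ring_simps)

lemma cohomology_class_eqI:
  assumes "z \<in> carrier (cocycle_ring X)" "c \<in> cochains X"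
    and "\<And>p \<sigma>. w p \<sigma> = coboundary X c p \<sigma> + z p \<sigma>"
  shows "cohomology_class X w = cohomology_class X z"
proof -
  interpret Z: abelian_group "cocycle_ring X"
    by (rule abelian_group_cocycle_ring)
  have "w = coboundary X c \<oplus>\<^bsub>cocycle_ring X\<^esub> z"
    using assms(3) by (simp add: cocycle_ring_simps fun_eq_iff)
  then have "w \<in> cohomology_class X z"
    using assms(2) by (auto simp: a_r_coset_def')
  then show ?thesis
    using Z.a_repr_independence [OF _ assms(1) subgroup_coboundaries] by metis
qed

lemma cochain_map_cocycle:
  assumes "continuous_map X Y f" "z \<in> carrier (cocycle_ring Y)"
  shows "cochain_map X f z \<in> carrier (cocycle_ring X)"
  using assms
  by (auto simp: cocycle_ring_simps cochain_map_in_cochains coboundary_cochain_map)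
     (simp add: cochain_map_def)

text \<open>The induced map is defined as a union over all cocycles of a class. Pullback takes
  coboundaries to coboundaries, hence all these cocycles contribute the same coset.\<close>

lemma cohom_induced_class:
  assumes f: "continuous_map X Y f" and z: "z \<in> carrier (cocycle_ring Y)"
  shows "cohom_induced X f (cohomology_class Y z) = cohomology_class X (cochain_map X f z)"
proof -
  have *: "cohomology_class X (cochain_map X f w) = cohomology_class X (cochain_map X f z)"
    if w: "w \<in> cohomology_class Y z" for w
  proof -
    obtain c where c: "c \<in> cochains Y" "w = (\<lambda>p \<sigma>. coboundary Y c p \<sigma> + z p \<sigma>)"
      using w by (auto simp: a_r_coset_def' cocycle_ring_simps)
    show ?thesis
      using c f
      by (intro cohomology_class_eqI [of _ _ "cochain_map X f c"] cochain_map_cocycle [OF f z]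
          cochain_map_in_cochains) (auto simp: cochain_map_add coboundary_cochain_map)
  qed
  moreover have "z \<in> cohomology_class Y z"
  proof -
    interpret Z: abelian_group "cocycle_ring Y"
      by (rule abelian_group_cocycle_ring)
    show ?thesis
      using Z.add.rcos_self [OF z subgroup_coboundaries] by (simp add: a_r_coset_def)
  qed
  ultimately show ?thesis
    unfolding cohom_induced_def by blast
qed

lemma cohom_induced_closed:
  assumes "continuous_map X Y f" "A \<in> carrier (cohomology_ring Y)"
  shows "cohom_induced X f A \<in> carrier (cohomology_ring X)"
  using assms
  by (auto simp: carrier_cohomology_ring cohom_induced_class cochain_map_cocycle)

lemma cohom_induced_hom:
  assumes f: "continuous_map X Y f"
  shows "group_hom (add_monoid (cohomology_ring Y)) (add_monoid (cohomology_ring X)) (cohom_induced X f)"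
proof -
  have "cohom_induced X f (A \<oplus>\<^bsub>cohomology_ring Y\<^esub> B) =
      cohom_induced X f A \<oplus>\<^bsub>cohomology_ring X\<^esub> cohom_induced X f B"
    if AB: "A \<in> carrier (cohomology_ring Y)" "B \<in> carrier (cohomology_ring Y)" for A B
  proof -
    obtain z w where z: "z \<in> carrier (cocycle_ring Y)" "A = cohomology_class Y z"
      and w: "w \<in> carrier (cocycle_ring Y)" "B = cohomology_class Y w"
      using AB by (auto simp: carrier_cohomology_ring)
    have "(\<lambda>p \<sigma>. z p \<sigma> + w p \<sigma>) \<in> carrier (cocycle_ring Y)"
      using abelian_groupE(1) [OF abelian_group_cocycle_ring z(1) w(1)]
      by (simp only: cocycle_ring_simps(2))
    with z w f show ?thesis
      by (simp add: add_cohomology_class cohom_induced_class cochain_map_cocycle cochain_map_add)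
  qed
  then show ?thesis
    using f by (intro group_hom.intro group_hom_axioms.intro group_cohomology)
      (auto simp: hom_def cohom_induced_closed)
qed

lemma subgroup_image_cohom_induced:
  assumes "continuous_map X Y f"
  shows "cohom_induced X f ` carrier (cohomology_ring Y) \<in> Sub (add_monoid (cohomology_ring X))"
  using group_hom.img_is_subgroup [OF cohom_induced_hom [OF assms]] by (simp add: Sub_def)

lemma cohom_induced_compose:
  assumes f: "continuous_map X Y f" and t: "continuous_map Y Z t"
    and A: "A \<in> carrier (cohomology_ring Z)"
  shows "cohom_induced X (t \<circ> f) A = cohom_induced X f (cohom_induced Y t A)"
proof -
  obtain z where z: "z \<in> carrier (cocycle_ring Z)" "A = cohomology_class Z z"
    using A by (auto simp: carrier_cohomology_ring)
  have "cochain_map X (t \<circ> f) z = cochain_map X f (cochain_map Y t z)"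
    using f by (auto simp: cochain_map_def fun_eq_iff simplex_map_compose singular_simplex_simplex_map)
  with z f t show ?thesis
    by (simp add: cohom_induced_class cochain_map_cocycle continuous_map_compose [OF f t])
qed

text \<open>Composing a cocycle \<open>z\<close> with the chain homotopy \<open>P\<close> gives a cochain \<open>d\<close> whose coboundary is
  the difference of the two pullbacks of \<open>z\<close>: the term \<open>z \<circ> \<partial> \<circ> P\<close> vanishes because \<open>z\<close> is a
  cocycle.\<close>

theorem cohom_induced_homotopic:
  assumes fg: "homotopic_with (\<lambda>_. True) X Y f g" and A: "A \<in> carrier (cohomology_ring Y)"
  shows "cohom_induced X f A = cohom_induced X g A"
proof -
  have f: "continuous_map X Y f" and g: "continuous_map X Y g"
    using homotopic_with_imp_continuous_maps [OF fg] by auto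
  obtain z where z: "z \<in> carrier (cocycle_ring Y)" and Az: "A = cohomology_class Y z"
    using A by (auto simp: carrier_cohomology_ring)
  obtain P where P_chain: "\<And>q c. singular_chain q X c \<Longrightarrow> singular_chain (Suc q) Y (P q c)"
    and P_diff: "\<And>q a b. P q (a - b) = P q a - P q b"
    and P_bd: "\<And>q c. singular_chain q X c \<Longrightarrow> chain_boundary (Suc q) (P q c) =
           chain_map q g c - chain_map q f c - P (q - 1) (chain_boundary q c)"
    using homotopic_imp_chain_homotopy [OF fg] by metis
  define d where "d = (\<lambda>p \<sigma>. if singular_simplex p X \<sigma>
      then cochain_eval (z (Suc p)) (P p (frag_of \<sigma>)) else 0)"
  have d_eval: "cochain_eval (d p) x = cochain_eval (z (Suc p)) (P p x)"
    if x: "singular_chain p X x" for p x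
  proof -
    have "cochain_eval (z (Suc p)) (P p x)
        = cochain_eval (\<lambda>\<sigma>. cochain_eval (z (Suc p)) (P p (frag_of \<sigma>))) x"
      by (rule additive_eq_cochain_eval) (simp add: P_diff cochain_eval_diff)
    also have "\<dots> = cochain_eval (d p) x"
      using x by (rule cochain_eval_cong) (simp add: d_def)
    finally show ?thesis ..
  qed
  have "d \<in> cochains X"
  proof -
    have "{p. d p \<noteq> (\<lambda>_. 0)} \<subseteq> Suc -` {p. z p \<noteq> (\<lambda>_. 0)}"
      by (auto simp: d_def cochain_eval_def)
    moreover have "finite (Suc -` {p. z p \<noteq> (\<lambda>_. 0)})"
      using z by (intro finite_vimageI) (auto simp: cocycle_ring_simps cochains_def)
    ultimately show ?thesis
      by (auto simp: cochains_def d_def intro: finite_subset)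
  qed
  moreover have "cochain_map X g z p \<sigma> = coboundary X d p \<sigma> + cochain_map X f z p \<sigma>" for p \<sigma>
  proof (cases "singular_simplex p X \<sigma>")
    case True
    then have \<sigma>: "singular_chain p X (frag_of \<sigma>)"
      by (simp add: singular_chain_of)
    have "0 = cochain_eval (coboundary Y z (Suc p)) (P p (frag_of \<sigma>))"
      using z by (simp add: cocycle_ring_simps cochain_eval_def)
    also have "\<dots> = cochain_eval (z p) (chain_boundary (Suc p) (P p (frag_of \<sigma>)))"
      using cochain_eval_coboundary [OF P_chain [OF \<sigma>]] by simp
    also have "\<dots> = z p (simplex_map p g \<sigma>) - z p (simplex_map p f \<sigma>)
        - cochain_eval (z p) (P (p - 1) (chain_boundary p (frag_of \<sigma>)))"
      by (simp add: P_bd [OF \<sigma>] cochain_eval_diff)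
    also have "cochain_eval (z p) (P (p - 1) (chain_boundary p (frag_of \<sigma>))) = coboundary X d p \<sigma>"
    proof (cases "p = 0")
      case True
      have "P 0 0 = 0"
        using P_diff [of 0 0 0] by simp
      with True show ?thesis
        by (simp add: coboundary_def chain_boundary_def)
    next
      case False
      then show ?thesis
        using d_eval [of "p - 1" "chain_boundary p (frag_of \<sigma>)"] singular_chain_boundary [OF \<sigma>] True
        by (simp add: coboundary_eq_eval)
    qed
    finally show ?thesis
      using True by (simp add: cochain_map_def)
  qed (simp add: cochain_map_def coboundary_def)
  ultimately have "cohomology_class X (cochain_map X g z) = cohomology_class X (cochain_map X f z)"
    by (rule cohomology_class_eqI [OF cochain_map_cocycle [OF f z]])
  then show ?thesis
    by (simp add: Az cohom_induced_class [OF f z] cohom_induced_class [OF g z])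
qed

section \<open>Vector bundles and their isomorphism classes\<close>

lemma vector_bundle_proj:
  "vector_bundle n X E \<Longrightarrow> e \<in> topspace (total_space E) \<Longrightarrow> bproj E e \<in> topspace X"
  by (auto simp: vector_bundle_def continuous_map_def)

lemma cvector_space_onD:
  assumes "cvector_space_on V vplus vscale" "v \<in> V"
  shows "w \<in> V \<Longrightarrow> vplus v w \<in> V" "vscale c v \<in> V"
proof -
  obtain z where "comm_group \<lparr>carrier = V, monoid.mult = vplus, one = z\<rparr>"
    using assms(1) by (auto simp: cvector_space_on_def)
  then interpret comm_group "\<lparr>carrier = V, monoid.mult = vplus, one = z\<rparr>" .
  show "vplus v w \<in> V" if "w \<in> V"
    using m_closed assms(2) that by simp
  show "vscale c v \<in> V"
    using assms by (simp add: cvector_space_on_def)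
qed

lemma vector_bundle_closed:
  assumes "vector_bundle n X E" "e \<in> topspace (total_space E)"
  shows "e' \<in> topspace (total_space E) \<Longrightarrow> bproj E e = bproj E e' \<Longrightarrow>
      badd E e e' \<in> topspace (total_space E) \<and> bproj E (badd E e e') = bproj E e"
    and "bscale E c e \<in> topspace (total_space E) \<and> bproj E (bscale E c e) = bproj E e"
proof -
  have "cvector_space_on (fibre E (bproj E e)) (badd E) (bscale E)"
    using assms vector_bundle_proj [OF assms] by (simp add: vector_bundle_def)
  moreover have "e \<in> fibre E (bproj E e)"
    using assms by (simp add: fibre_def)
  ultimately show "e' \<in> topspace (total_space E) \<Longrightarrow> bproj E e = bproj E e' \<Longrightarrow>
      badd E e e' \<in> topspace (total_space E) \<and> bproj E (badd E e e') = bproj E e"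
    and "bscale E c e \<in> topspace (total_space E) \<and> bproj E (bscale E c e) = bproj E e"
    using cvector_space_onD by (fastforce simp: fibre_def)+
qed

text \<open>Naming the isomorphism lets its properties be cited one at a time in \<open>is_bundle_isoD\<close>.\<close>

definition is_bundle_iso :: "('a, 'e) cbundle \<Rightarrow> ('a, 'f) cbundle \<Rightarrow> ('e \<Rightarrow> 'f) \<Rightarrow> bool" where
  "is_bundle_iso E F \<phi> \<longleftrightarrow>
     homeomorphic_map (total_space E) (total_space F) \<phi> \<and>
     (\<forall>e\<in>topspace (total_space E). bproj F (\<phi> e) = bproj E e) \<and>
     (\<forall>e\<in>topspace (total_space E). \<forall>e'\<in>topspace (total_space E).
        bproj E e = bproj E e' \<longrightarrow> \<phi> (badd E e e') = badd F (\<phi> e) (\<phi> e')) \<and>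
     (\<forall>c. \<forall>e\<in>topspace (total_space E). \<phi> (bscale E c e) = bscale F c (\<phi> e))"

lemma bundle_iso_iff: "bundle_iso E F \<longleftrightarrow> (\<exists>\<phi>. is_bundle_iso E F \<phi>)"
  by (simp add: bundle_iso_def is_bundle_iso_def)

lemma is_bundle_isoD:
  assumes "is_bundle_iso E F \<phi>"
  shows "homeomorphic_map (total_space E) (total_space F) \<phi>"
    and "e \<in> topspace (total_space E) \<Longrightarrow> \<phi> e \<in> topspace (total_space F)"
    and "e \<in> topspace (total_space E) \<Longrightarrow> bproj F (\<phi> e) = bproj E e"
    and "\<lbrakk>e \<in> topspace (total_space E); e' \<in> topspace (total_space E); bproj E e = bproj E e'\<rbrakk>
      \<Longrightarrow> \<phi> (badd E e e') = badd F (\<phi> e) (\<phi> e')"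
    and "e \<in> topspace (total_space E) \<Longrightarrow> \<phi> (bscale E c e) = bscale F c (\<phi> e)"
proof -
  show hom: "homeomorphic_map (total_space E) (total_space F) \<phi>"
    using assms by (simp add: is_bundle_iso_def)
  show "\<phi> e \<in> topspace (total_space F)" if "e \<in> topspace (total_space E)"
    using homeomorphic_imp_surjective_map [OF hom] that by blast
qed (use assms in \<open>auto simp: is_bundle_iso_def\<close>)

lemma bundle_iso_trans:
  assumes "bundle_iso E F" "bundle_iso F G"
  shows "bundle_iso E G"
proof -
  obtain \<phi> \<psi> where "is_bundle_iso E F \<phi>" "is_bundle_iso F G \<psi>"
    using assms by (auto simp: bundle_iso_iff)
  note \<phi> = is_bundle_isoD [OF this(1)] and \<psi> = is_bundle_isoD [OF this(2)]
  have "is_bundle_iso E G (\<psi> \<circ> \<phi>)"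
    unfolding is_bundle_iso_def
    by (simp add: homeomorphic_map_compose [OF \<phi>(1) \<psi>(1)] \<phi>(2-) \<psi>(2-))
  then show ?thesis
    by (auto simp: bundle_iso_iff)
qed

text \<open>The inverse respects sums and multiples because these stay within the total space of \<open>E\<close>;
  for that \<open>E\<close> has to be a vector bundle and not just an arbitrary record.\<close>

lemma bundle_iso_sym:
  assumes E: "vector_bundle n X E" and "bundle_iso E F"
  shows "bundle_iso F E"
proof -
  obtain \<phi> where "is_bundle_iso E F \<phi>"
    using assms(2) by (auto simp: bundle_iso_iff)
  note \<phi> = is_bundle_isoD(1,2) [OF this] and proj = is_bundle_isoD(3) [OF this]
    and add = is_bundle_isoD(4) [OF this] and scale = is_bundle_isoD(5) [OF this]
  obtain \<psi> where "homeomorphic_maps (total_space E) (total_space F) \<phi> \<psi>"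
    using \<phi>(1) homeomorphic_map_maps by blast
  then have \<psi>: "homeomorphic_map (total_space F) (total_space E) \<psi>"
      "\<And>e. e \<in> topspace (total_space E) \<Longrightarrow> \<psi> (\<phi> e) = e"
      "\<And>e. e \<in> topspace (total_space F) \<Longrightarrow> \<phi> (\<psi> e) = e"
    by (auto simp: homeomorphic_maps_map)
  have mem: "\<psi> e \<in> topspace (total_space E)" if "e \<in> topspace (total_space F)" for e
    using homeomorphic_imp_surjective_map [OF \<psi>(1)] that by blast
  have \<psi>_proj: "bproj E (\<psi> e) = bproj F e" if "e \<in> topspace (total_space F)" for e
    using proj [OF mem [OF that]] \<psi>(3) [OF that] by simp
  have "\<psi> (badd F e e') = badd E (\<psi> e) (\<psi> e')"
    if e: "e \<in> topspace (total_space F)" "e' \<in> topspace (total_space F)" "bproj F e = bproj F e'" for e e'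
  proof -
    have eq: "bproj E (\<psi> e) = bproj E (\<psi> e')"
      using \<psi>_proj e by simp
    then have "badd E (\<psi> e) (\<psi> e') \<in> topspace (total_space E)"
      using vector_bundle_closed(1) [OF E] mem e by blast
    then show ?thesis
      using \<psi>(2) add [OF mem mem eq] \<psi>(3) e by metis
  qed
  moreover have "\<psi> (bscale F c e) = bscale E c (\<psi> e)" if e: "e \<in> topspace (total_space F)" for c e
    using \<psi>(2) [of "bscale E c (\<psi> e)"] vector_bundle_closed(2) [OF E mem [OF e]]
      scale [OF mem [OF e]] \<psi>(3) [OF e] by simp
  ultimately have "is_bundle_iso F E \<psi>"
    unfolding is_bundle_iso_def using \<psi>(1) \<psi>_proj by simp
  then show ?thesis
    by (auto simp: bundle_iso_iff)
qed

lemma cvector_space_on_transport: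
  assumes V: "cvector_space_on V vplus vscale" and \<phi>: "bij_betw \<phi> V W"
    and add: "\<And>v w. v \<in> V \<Longrightarrow> w \<in> V \<Longrightarrow> \<phi> (vplus v w) = wplus (\<phi> v) (\<phi> w)"
    and scale: "\<And>c v. v \<in> V \<Longrightarrow> \<phi> (vscale c v) = wscale c (\<phi> v)"
  shows "cvector_space_on W wplus wscale"
proof -
  note V_closed = cvector_space_onD [OF V]
  have W: "W = \<phi> ` V"
    using \<phi> by (simp add: bij_betw_def)
  obtain z where z: "comm_group \<lparr>carrier = V, monoid.mult = vplus, one = z\<rparr>"
    using V by (auto simp: cvector_space_on_def)
  have "\<phi> \<in> iso \<lparr>carrier = V, monoid.mult = vplus, one = z\<rparr>
              \<lparr>carrier = W, monoid.mult = wplus, one = undefined\<rparr>"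
    using \<phi> by (auto simp: iso_def hom_def W add)
  from comm_group.iso_imp_img_comm_group [OF z this]
  have "comm_group \<lparr>carrier = W, monoid.mult = wplus, one = \<phi> z\<rparr>"
    by simp
  then show ?thesis
    using V V_closed unfolding cvector_space_on_def W
    by (auto simp flip: add scale)
qed

lemma vector_bundle_transport:
  fixes E :: "('a, 'e) cbundle" and F :: "('a, 'f) cbundle"
  assumes E: "vector_bundle n X E" and "bundle_iso E F"
  shows "vector_bundle n X F"
proof -
  obtain \<phi> where "is_bundle_iso E F \<phi>"
    using assms(2) by (auto simp: bundle_iso_iff)
  note \<phi> = is_bundle_isoD(1,2) [OF this] and proj = is_bundle_isoD(3) [OF this]
    and add = is_bundle_isoD(4) [OF this] and scale = is_bundle_isoD(5) [OF this]
  obtain \<psi> where \<psi>: "homeomorphic_maps (total_space E) (total_space F) \<phi> \<psi>"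
    using \<phi>(1) homeomorphic_map_maps by blast
  then have \<psi>_mem: "\<And>e. e \<in> topspace (total_space F) \<Longrightarrow> \<psi> e \<in> topspace (total_space E)"
    and \<phi>\<psi>: "\<And>e. e \<in> topspace (total_space F) \<Longrightarrow> \<phi> (\<psi> e) = e"
    by (auto simp: homeomorphic_maps_def continuous_map_def)
  have surj: "\<phi> ` topspace (total_space E) = topspace (total_space F)"
    and inj: "inj_on \<phi> (topspace (total_space E))"
    using homeomorphic_imp_surjective_map [OF \<phi>(1)] homeomorphic_imp_injective_map [OF \<phi>(1)] by auto
  have "continuous_map (total_space F) X (bproj F)"
  proof (rule continuous_map_eq)
    show "continuous_map (total_space F) X (bproj E \<circ> \<psi>)"
      using \<psi> E by (intro continuous_map_compose) (auto simp: homeomorphic_maps_def vector_bundle_def)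
    show "(bproj E \<circ> \<psi>) e = bproj F e" if "e \<in> topspace (total_space F)" for e
      using proj [OF \<psi>_mem [OF that]] \<phi>\<psi> [OF that] by simp
  qed
  moreover have "cvector_space_on (fibre F x) (badd F) (bscale F)" if x: "x \<in> topspace X" for x
  proof (rule cvector_space_on_transport)
    show "cvector_space_on (fibre E x) (badd E) (bscale E)"
      using E x by (simp add: vector_bundle_def)
    show "bij_betw \<phi> (fibre E x) (fibre F x)"
      unfolding bij_betw_def
    proof
      show "inj_on \<phi> (fibre E x)"
        using inj by (rule inj_on_subset) (auto simp: fibre_def)
      show "\<phi> ` fibre E x = fibre F x"
        using surj proj by (fastforce simp: fibre_def)
    qed
  qed (use add scale in \<open>auto simp: fibre_def\<close>)
  moreover have "\<exists>U h. openin X U \<and> x \<in> U \<and> local_trivialization n X F U h" if x: "x \<in> topspace X" for x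
  proof -
    obtain U h where U: "openin X U" "x \<in> U" and h: "local_trivialization n X E U h"
      using E x by (auto simp: vector_bundle_def)
    have hom: "homeomorphic_map (prod_topology (subtopology X U) (cspace n))
       (subtopology (total_space E) {e. bproj E e \<in> U}) h"
      using h by (simp add: local_trivialization_def)
    have h_mem: "h (y, v) \<in> topspace (total_space E)"
      if "y \<in> U" "v \<in> topspace (cspace n)" for y v
      using that U(1) homeomorphic_imp_surjective_map [OF hom] openin_subset by fastforce
    have "homeomorphic_map (subtopology (total_space E) {e. bproj E e \<in> U})
            (subtopology (total_space F) {e. bproj F e \<in> U}) \<phi>"
      by (rule homeomorphic_map_subtopologies_alt [OF \<phi>(1)]) (simp add: proj)
    then have "homeomorphic_map (prod_topology (subtopology X U) (cspace n))
            (subtopology (total_space F) {e. bproj F e \<in> U}) (\<phi> \<circ> h)"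
      by (rule homeomorphic_map_compose [OF hom])
    then have "local_trivialization n X F U (\<phi> \<circ> h)"
      using h h_mem proj add scale by (simp add: local_trivialization_def)
    with U show ?thesis
      by blast
  qed
  ultimately show ?thesis
    by (simp add: vector_bundle_def)
qed

text \<open>Transport of structure along an injection of the total space, with the quotient topology
  on the image.\<close>

lemma bundle_iso_image:
  fixes E :: "('a, 'e) cbundle" and \<phi> :: "'e \<Rightarrow> 'f"
  assumes inj: "inj_on \<phi> (topspace (total_space E))"
    and proj: "\<And>e. e \<in> topspace (total_space E) \<Longrightarrow> \<pi> (\<phi> e) = bproj E e"
  shows "\<exists>F :: ('a, 'f) cbundle. bundle_iso E F"
proof -
  define \<psi> where "\<psi> = inv_into (topspace (total_space E)) \<phi>"
  have \<psi>: "\<psi> (\<phi> e) = e" if "e \<in> topspace (total_space E)" for e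
    using that inj by (simp add: \<psi>_def)
  define F :: "('a, 'f) cbundle" where
    "F = \<lparr>total_space = quotient_topology (total_space E) \<phi>, bproj = \<pi>,
          badd = (\<lambda>u v. \<phi> (badd E (\<psi> u) (\<psi> v))), bscale = (\<lambda>c u. \<phi> (bscale E c (\<psi> u)))\<rparr>"
  have "homeomorphic_map (total_space E) (total_space F) \<phi>"
    using inj by (simp add: F_def homeomorphic_map_def quotient_map_quotient_topology)
  then have "is_bundle_iso E F \<phi>"
    unfolding is_bundle_iso_def by (simp add: F_def proj \<psi>)
  then show ?thesis
    by (auto simp: bundle_iso_iff)
qed

text \<open>A point \<open>e\<close> of the total space is determined by its base point \<open>x\<close> and its coordinates in a
  trivialization chosen for \<open>x\<close>. This injects any total space into the type in which isomorphism
  classes are formed, so that the class of a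
  vector bundle is never empty.\<close>

lemma vector_bundle_representative:
  assumes E: "vector_bundle n X E"
  shows "\<exists>B :: 'a vbundle. vector_bundle n X (B :: 'a vbundle) \<and> bundle_iso E B"
proof -
  have "\<forall>x\<in>topspace X. \<exists>U h. x \<in> U \<and> openin X U \<and> local_trivialization n X E U h"
    using E unfolding vector_bundle_def by blast
  then obtain U h where U: "\<And>x. x \<in> topspace X \<Longrightarrow> x \<in> U x" "\<And>x. x \<in> topspace X \<Longrightarrow> openin X (U x)"
    and h: "\<And>x. x \<in> topspace X \<Longrightarrow> local_trivialization n X E (U x) (h x)"
    by metis
  have ex: "\<exists>v. h (bproj E e) (bproj E e, v) = e" if e: "e \<in> topspace (total_space E)" for e
  proof -
    let ?x = "bproj E e"
    have x: "?x \<in> topspace X"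
      using E e by (rule vector_bundle_proj)
    then have "homeomorphic_map (prod_topology (subtopology X (U ?x)) (cspace n))
       (subtopology (total_space E) {e. bproj E e \<in> U ?x}) (h ?x)"
      using h by (simp add: local_trivialization_def)
    from homeomorphic_imp_surjective_map [OF this]
    have "e \<in> h ?x ` topspace (prod_topology (subtopology X (U ?x)) (cspace n))"
      using e U(1) [OF x] by simp
    then obtain y v where yv: "y \<in> U ?x" "v \<in> topspace (cspace n)" "h ?x (y, v) = e"
      by auto
    then have "y = ?x"
      using h [OF x] unfolding local_trivialization_def by metis
    with yv show ?thesis
      by blast
  qed
  define coord where "coord e = (SOME v. h (bproj E e) (bproj E e, v) = e)" for e
  have coord: "h (bproj E e) (bproj E e, coord e) = e" if "e \<in> topspace (total_space E)" for e
    unfolding coord_def using ex [OF that] by (rule someI_ex)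
  \<comment> \<open>The middle component is a dummy that makes the triple fit the type.\<close>
  define \<phi> where "\<phi> e = (bproj E e, {} :: cvec set, coord e)" for e
  have "inj_on \<phi> (topspace (total_space E))"
    by (rule inj_onI) (metis \<phi>_def coord prod.inject)
  moreover have "\<And>e. fst (\<phi> e) = bproj E e"
    by (simp add: \<phi>_def)
  ultimately obtain B :: "'a vbundle" where "bundle_iso E B"
    using bundle_iso_image by blast
  with vector_bundle_transport [OF E] show ?thesis
    by blast
qed

lemma vect_class_cong:
  assumes "vector_bundle n X E" "bundle_iso E F"
  shows "vect_class n X E = vect_class n X F"
  unfolding vect_class_def
  using bundle_iso_trans [OF _ assms(2)] bundle_iso_trans [OF _ bundle_iso_sym [OF assms]] by blast

lemma vect_class_in_Vect:
  fixes E :: "('a, 'e) cbundle"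
  assumes "vector_bundle n X E"
  shows "vect_class n X E \<in> Vect n X"
  using vector_bundle_representative [OF assms] vect_class_cong [OF assms]
  unfolding Vect_def by blast

lemma vect_class_nonempty:
  assumes "vector_bundle n X E"
  shows "vect_class n X E \<noteq> {}"
  using vector_bundle_representative [OF assms] bundle_iso_sym [OF assms]
  unfolding vect_class_def by blast

lemma vect_class_member:
  assumes "B \<in> vect_class n X E"
  shows "vector_bundle n X B" "vect_class n X B = vect_class n X E"
proof -
  have B: "vector_bundle n X B" "bundle_iso B E"
    using assms by (simp_all add: vect_class_def)
  then show "vector_bundle n X B" "vect_class n X B = vect_class n X E"
    using vect_class_cong by blast+
qed

section \<open>Homotopy classes and their action on cohomology\<close>

lemma hclass_eq_iff:
  assumes "continuous_map X Y f" "continuous_map X Y g"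
  shows "hclass X Y f = hclass X Y g \<longleftrightarrow> homotopic_with (\<lambda>_. True) X Y f g"
proof
  have "g \<in> hclass X Y g"
    using assms(2) by (simp add: hclass_def)
  moreover assume "hclass X Y f = hclass X Y g"
  ultimately show "homotopic_with (\<lambda>_. True) X Y f g"
    by (metis hclass_def mem_Collect_eq)
next
  assume fg: "homotopic_with (\<lambda>_. True) X Y f g"
  show "hclass X Y f = hclass X Y g"
    unfolding hclass_def using homotopic_with_trans [OF fg]
      homotopic_with_trans [OF homotopic_with_symD [OF fg]] by blast
qed

text \<open>The composite of two homotopy classes is the class of the composite of any representatives.
  Reading this off at \<open>f\<close>, a member of its own class, gives a factorization up to homotopy.\<close>

lemma hleqL_factor:
  assumes f: "continuous_map X Y f" and "hleqL X Y (hclass X Y f) (hclass X Y g)"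
  shows "\<exists>t. continuous_map Y Y t \<and> homotopic_with (\<lambda>_. True) X Y f (t \<circ> g)"
proof -
  obtain s where s: "continuous_map Y Y s"
    and eq: "hclass X Y f = hcompose X Y (hclass Y Y s) (hclass X Y g)"
    using assms(2) by (auto simp: hleqL_def hclasses_def)
  have "f \<in> hclass X Y f"
    using f by (simp add: hclass_def)
  then obtain t g' where t: "homotopic_with (\<lambda>_. True) Y Y s t"
    and g': "homotopic_with (\<lambda>_. True) X Y g g'" and f': "homotopic_with (\<lambda>_. True) X Y (t \<circ> g') f"
    unfolding eq by (auto simp: hcompose_def hclass_def)
  have t_cont: "continuous_map Y Y t"
    using t homotopic_with_imp_continuous_maps by blast
  have "homotopic_with (\<lambda>_. True) X Y (t \<circ> g) (t \<circ> g')"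
    using g' t_cont by (rule homotopic_with_compose_continuous_map_left) simp
  with t_cont show ?thesis
    using homotopic_with_trans [OF _ f'] homotopic_with_symD by blast
qed

text \<open>If \<open>f\<close> factors as \<open>t \<circ> g\<close> up to homotopy, then \<open>f\<^sup>* = g\<^sup>* \<circ> t\<^sup>*\<close>, so each class \<open>f\<^sup>* \<alpha>\<close> is the
  class \<open>g\<^sup>* (t\<^sup>* \<alpha>)\<close>.\<close>

lemma cohom_induced_image_mono:
  assumes f: "continuous_map X Y f" and g: "continuous_map X Y g"
    and le: "hleqL X Y (hclass X Y f) (hclass X Y g)"
  shows "cohom_induced X f ` carrier (cohomology_ring Y) \<subseteq>
    cohom_induced X g ` carrier (cohomology_ring Y)"
proof
  obtain t where t: "continuous_map Y Y t" "homotopic_with (\<lambda>_. True) X Y f (t \<circ> g)"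
    using hleqL_factor [OF f le] by blast
  fix B assume "B \<in> cohom_induced X f ` carrier (cohomology_ring Y)"
  then obtain A where A: "A \<in> carrier (cohomology_ring Y)" "B = cohom_induced X f A"
    by blast
  then have "B = cohom_induced X g (cohom_induced Y t A)"
    using cohom_induced_homotopic [OF t(2)] cohom_induced_compose [OF g t(1)] by simp
  then show "B \<in> cohom_induced X g ` carrier (cohomology_ring Y)"
    using cohom_induced_closed [OF t(1) A(1)] by blast
qed

section \<open>Classifying maps and characteristic classes\<close>

text \<open>The classification theorem for rank \<open>n\<close> bundles over \<open>X\<close>, as a hypothesis on \<open>X\<close>.\<close>

locale bundle_classification =
  fixes X :: "'a topology" and n :: nat
    and \<Phi> :: "('a \<Rightarrow> cvec set) set \<Rightarrow> 'a vbundle set"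
  assumes \<Phi>_hclass: "continuous_map X (Gr n) f \<Longrightarrow>
        \<Phi> (hclass X (Gr n) f) = vect_class n X (pullback_bundle X f (univ_bundle n))"
    and \<Phi>_bij: "bij_betw \<Phi> (hclasses X (Gr n)) (Vect n X)"
begin

text \<open>Surjectivity of \<open>\<Phi>\<close> only gives an equality of isomorphism classes. A common member \<open>B\<close> of the
  two classes turns it into an isomorphism of \<open>E\<close> with the pullback.\<close>

lemma classifying_map_exists:
  assumes E: "vector_bundle n X E"
  shows "\<exists>f. is_classifying_map n X E f"
proof -
  have "vect_class n X E \<in> \<Phi> ` hclasses X (Gr n)"
    using \<Phi>_bij vect_class_in_Vect [OF E] by (simp add: bij_betw_def)
  then obtain f where f: "continuous_map X (Gr n) f"
    and eq: "vect_class n X E = vect_class n X (pullback_bundle X f (univ_bundle n))"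
    using \<Phi>_hclass by (auto simp: hclasses_def)
  obtain B where "B \<in> vect_class n X E"
    using vect_class_nonempty [OF E] by blast
  then have B: "vector_bundle n X B" "bundle_iso B E"
    and "bundle_iso B (pullback_bundle X f (univ_bundle n))"
    unfolding eq [symmetric] using eq by (auto simp: vect_class_def)
  then have "bundle_iso E (pullback_bundle X f (univ_bundle n))"
    using bundle_iso_trans [OF bundle_iso_sym [OF B]] by blast
  with f show ?thesis
    by (auto simp: is_classifying_map_def)
qed

lemma classifying_map:
  assumes "vector_bundle n X E"
  shows "is_classifying_map n X E (classifying_map n X E)"
  unfolding classifying_map_def using classifying_map_exists [OF assms] by (rule someI_ex)

lemma is_classifying_mapD:
  assumes "vector_bundle n X E" "is_classifying_map n X E f"
  shows "continuous_map X (Gr n) f" "\<Phi> (hclass X (Gr n) f) = vect_class n X E"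
proof -
  show f: "continuous_map X (Gr n) f"
    using assms(2) by (simp add: is_classifying_map_def)
  show "\<Phi> (hclass X (Gr n) f) = vect_class n X E"
    using assms vect_class_cong \<Phi>_hclass [OF f] by (metis is_classifying_map_def)
qed

text \<open>Injectivity of \<open>\<Phi>\<close>. The total spaces of \<open>E\<close> and \<open>F\<close> may have different types, so \<open>E \<cong> F\<close> is
  expressed through the classes.\<close>

lemma classifying_maps_hclass_eq:
  assumes E: "vector_bundle n X E" "is_classifying_map n X E f"
    and F: "vector_bundle n X F" "is_classifying_map n X F g"
    and EF: "vect_class n X E = vect_class n X F"
  shows "hclass X (Gr n) f = hclass X (Gr n) g"
proof -
  have "inj_on \<Phi> (hclasses X (Gr n))"
    using \<Phi>_bij by (simp add: bij_betw_def)
  moreover have "hclass X (Gr n) f \<in> hclasses X (Gr n)" "hclass X (Gr n) g \<in> hclasses X (Gr n)"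
    using is_classifying_mapD(1) [OF E] is_classifying_mapD(1) [OF F] by (auto simp: hclasses_def)
  moreover have "\<Phi> (hclass X (Gr n) f) = \<Phi> (hclass X (Gr n) g)"
    using is_classifying_mapD(2) [OF E] is_classifying_mapD(2) [OF F] EF by simp
  ultimately show ?thesis
    by (simp add: inj_on_eq_iff)
qed

lemma Im_H_vect_class:
  assumes E: "vector_bundle n X E" "is_classifying_map n X E f"
  shows "Im_H n X (vect_class n X E) = cohom_induced X f ` carrier (cohomology_ring (Gr n))"
proof -
  define B where "B = (SOME B. B \<in> vect_class n X E)"
  have "B \<in> vect_class n X E"
    unfolding B_def using vect_class_nonempty [OF E(1)] by (simp add: some_in_eq)
  note B = vect_class_member [OF this]
  have "hclass X (Gr n) (classifying_map n X B) = hclass X (Gr n) f"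
    using B(1) classifying_map [OF B(1)] E B(2) by (rule classifying_maps_hclass_eq)
  then have "homotopic_with (\<lambda>_. True) X (Gr n) (classifying_map n X B) f"
    using is_classifying_mapD(1) [OF B(1) classifying_map [OF B(1)]] is_classifying_mapD(1) [OF E]
    by (simp add: hclass_eq_iff)
  then show ?thesis
    unfolding Im_H_def B_def [symmetric] using cohom_induced_homotopic by (metis image_cong)
qed

lemma Im_H_vect_class_eq_char_classes:
  assumes "vector_bundle n X E"
  shows "Im_H n X (vect_class n X E) = char_classes n X E"
  unfolding Im_H_vect_class [OF assms classifying_map [OF assms]] char_classes_def by blast

lemma vect_leqL_iff:
  assumes E: "vector_bundle n X E" "is_classifying_map n X E f"
    and F: "vector_bundle n X F" "is_classifying_map n X F g"
  shows "vect_leqL n X (vect_class n X E) (vect_class n X F) \<longleftrightarrow>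
    hleqL X (Gr n) (hclass X (Gr n) f) (hclass X (Gr n) g)"
proof -
  have E': "hclass X (Gr n) (classifying_map n X B) = hclass X (Gr n) f"
    if "B \<in> vect_class n X E" for B
    using vect_class_member [OF that] classifying_map E by (intro classifying_maps_hclass_eq)
  have F': "hclass X (Gr n) (classifying_map n X B) = hclass X (Gr n) g"
    if "B \<in> vect_class n X F" for B
    using vect_class_member [OF that] classifying_map F by (intro classifying_maps_hclass_eq)
  show ?thesis
    unfolding vect_leqL_def
    using E' F' vect_class_nonempty [OF E(1)] vect_class_nonempty [OF F(1)] by force
qed

lemma char_classes_mono:
  assumes E: "vector_bundle n X E" and F: "vector_bundle n X F"
    and le: "vect_leqL n X (vect_class n X E) (vect_class n X F)"
  shows "char_classes n X E \<subseteq> char_classes n X F"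
proof -
  note cE = classifying_map [OF E] and cF = classifying_map [OF F]
  have "hleqL X (Gr n) (hclass X (Gr n) (classifying_map n X E)) (hclass X (Gr n) (classifying_map n X F))"
    using le vect_leqL_iff [OF E cE F cF] by simp
  then show ?thesis
    using cohom_induced_image_mono is_classifying_mapD(1) [OF E cE] is_classifying_mapD(1) [OF F cF]
    unfolding Im_H_vect_class_eq_char_classes [OF E, symmetric] Im_H_vect_class_eq_char_classes [OF F, symmetric]
      Im_H_vect_class [OF E cE] Im_H_vect_class [OF F cF] by blast
qed

lemma Im_H_in_Sub: "Im_H n X \<in> Vect n X \<rightarrow> Sub (add_monoid (cohomology_ring X))"
proof
  fix a assume "a \<in> Vect n X"
  then obtain B :: "'a vbundle" where B: "vector_bundle n X B" "a = vect_class n X B"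
    by (auto simp: Vect_def)
  then show "Im_H n X a \<in> Sub (add_monoid (cohomology_ring X))"
    using Im_H_vect_class [OF B(1) classifying_map [OF B(1)]]
      subgroup_image_cohom_induced is_classifying_mapD(1) [OF B(1) classifying_map [OF B(1)]]
    by simp
qed

lemma Im_H_monotone: "monotone_on (Vect n X) (vect_leqL n X) (\<subseteq>) (Im_H n X)"
proof (rule monotone_onI)
  fix a b assume "a \<in> Vect n X" "b \<in> Vect n X" and le: "vect_leqL n X a b"
  then obtain A B :: "'a vbundle" where "vector_bundle n X A" "a = vect_class n X A"
    and "vector_bundle n X B" "b = vect_class n X B"
    by (auto simp: Vect_def)
  with le show "Im_H n X a \<subseteq> Im_H n X b"
    using char_classes_mono by (simp add: Im_H_vect_class_eq_char_classes)
qed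

end

theorem mainTheorem6:
  fixes X :: "'a topology" and n :: nat
    and \<Phi> :: "('a \<Rightarrow> cvec set) set \<Rightarrow> 'a vbundle set"
    and E :: "('a, 'e) cbundle" and F :: "('a, 'f) cbundle"
  assumes "\<And>f. continuous_map X (Gr n) f \<Longrightarrow>
             \<Phi> (hclass X (Gr n) f) = vect_class n X (pullback_bundle X f (univ_bundle n))"
    and "bij_betw \<Phi> (hclasses X (Gr n)) (Vect n X)"
    and "vector_bundle n X E" and "vector_bundle n X F"
  shows "vect_class n X E \<in> Vect n X
    \<and> (\<exists>f. is_classifying_map n X E f)
    \<and> (\<forall>f. is_classifying_map n X E f \<longrightarrow>
          Im_H n X (vect_class n X E) = cohom_induced X f ` carrier (cohomology_ring (Gr n)))
    \<and> Im_H n X (vect_class n X E) = char_classes n X E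
    \<and> Im_H n X \<in> Vect n X \<rightarrow> Sub (add_monoid (cohomology_ring X))
    \<and> monotone_on (Vect n X) (vect_leqL n X) (\<subseteq>) (Im_H n X)
    \<and> (\<forall>f g. is_classifying_map n X E f \<and> is_classifying_map n X F g \<longrightarrow>
          (vect_leqL n X (vect_class n X E) (vect_class n X F) \<longleftrightarrow>
           hleqL X (Gr n) (hclass X (Gr n) f) (hclass X (Gr n) g)))
    \<and> (vect_leqL n X (vect_class n X E) (vect_class n X F) \<longrightarrow> char_classes n X E \<subseteq> char_classes n X F)
    \<and> (vect_simL n X (vect_class n X E) (vect_class n X F) \<longrightarrow> char_classes n X E = char_classes n X F)"
proof -
  interpret bundle_classification X n \<Phi>
    using assms(1,2) by unfold_locales
  note E = \<open>vector_bundle n X E\<close> and F = \<open>vector_bundle n X F\<close>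
  show ?thesis
  proof (intro conjI)
    show "vect_class n X E \<in> Vect n X"
      using E by (rule vect_class_in_Vect)
    show "\<exists>f. is_classifying_map n X E f"
      using E by (rule classifying_map_exists)
    show "\<forall>f. is_classifying_map n X E f \<longrightarrow>
        Im_H n X (vect_class n X E) = cohom_induced X f ` carrier (cohomology_ring (Gr n))"
      using Im_H_vect_class [OF E] by blast
    show "Im_H n X (vect_class n X E) = char_classes n X E"
      using E by (rule Im_H_vect_class_eq_char_classes)
    show "Im_H n X \<in> Vect n X \<rightarrow> Sub (add_monoid (cohomology_ring X))"
      by (rule Im_H_in_Sub)
    show "monotone_on (Vect n X) (vect_leqL n X) (\<subseteq>) (Im_H n X)"
      by (rule Im_H_monotone)
    show "\<forall>f g. is_classifying_map n X E f \<and> is_classifying_map n X F g \<longrightarrow>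
          (vect_leqL n X (vect_class n X E) (vect_class n X F) \<longleftrightarrow>
           hleqL X (Gr n) (hclass X (Gr n) f) (hclass X (Gr n) g))"
      using vect_leqL_iff [OF E _ F] by blast
    show "vect_leqL n X (vect_class n X E) (vect_class n X F) \<longrightarrow>
        char_classes n X E \<subseteq> char_classes n X F"
      using char_classes_mono [OF E F] by blast
    show "vect_simL n X (vect_class n X E) (vect_class n X F) \<longrightarrow>
        char_classes n X E = char_classes n X F"
      using char_classes_mono [OF E F] char_classes_mono [OF F E] by (auto simp: vect_simL_def)
  qed
qed

end
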